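(* Let $\mathbf{k}$ be an infinite field, let $n\ge 2$, and let $A=\{a_1=0,a_2,\dots,a_n\}$ be a set of integers with $0=a_1<a_2<\cdots<a_n$ and $\gcd(a_2,\dots,a_n)=1$. Let $\sigma$ be a positive integer, $c_1,c_2$ non-negative integers, and $C_1\subset[0,c_1-2]$, $C_2\subset[0,c_2-2]$ finite sets such that $$sA=C_1\sqcup[c_1,s\,a_n-c_2]\sqcup(\{s\,a_n\}-C_2)\quad\text{for all } s\ge\sigma$$ (such data exist). Let $\Gamma_1=\langle a_1,\dots,a_n\rangle$ and $\Gamma_2=\langle a_n-a_{n-1},\dots,a_n-a_2,a_n\rangle$. Then for $i=1,2$: $$\delta(C_A,P_i)=c_i-|C_i|,$$ $c_i$ is the conductor of $\Gamma_i$, and $C_i=\Gamma_i\cap[0,c_i-2]$.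
   Context: For $s\ge 1$, $sA=\{a_{i_1}+\cdots+a_{i_s}\mid 1\le i_1\le\cdots\le i_s\le n\}$ is the $s$-fold iterated sumset. $[a,b]$ denotes the set of integers $m$ with $a\le m\le b$ (empty if $b<a$), $\sqcup$ is disjoint union, and $\{s a_n\}-C_2=\{s a_n-x\mid x\in C_2\}$. $\langle b_1,\dots,b_m\rangle$ denotes the sub-semigroup of $\mathbb{N}$ (containing $0$) generated by $b_1,\dots,b_m$. The conductor of a numerical semigroup $\Gamma$ is the least $c\in\mathbb{N}$ such that every integer $m\ge c$ lies in $\Gamma$. The monomial projective curve $C_A\subset\mathbb{P}^{n-1}_{\mathbf{k}}$ is defined by the homogeneous ideal $\ker(\psi)$, where $\psi:\mathbf{k}[X_1,\dots,X_n]\to\mathbf{k}[u,v]$ is the $\mathbf{k}$-algebra morphism with $\psi(X_i)=u^{a_n-a_i}v^{a_i}$. The points are $P_1=(1,0,\dots,0)$ and $P_2=(0,\dots,0,1)$ of $\mathbb{P}^{n-1}_{\mathbf{k}}$. For $P\in C_A$, $\delta(C_A,P)=\dim_{\mathbf{k}}\overline{\mathcal{O}_{C_A,P}}/\mathcal{O}_{C_A,P}$, where the over-line denotes integral closure in the field of fractions. (Equivalently, $\delta(C_A,P_i)=|\mathbb{N}\setminus\Gamma_i|$ for $i=1,2$.) *)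

theory Defs
  imports
    "HOL-Library.Poly_Mapping"
    "HOL-Library.Extended_Nat"
    "HOL-Computational_Algebra.Polynomial"
    "HOL-Algebra.Polynomials"
    "HOL-Algebra.Generated_Fields"
    "HOL-Algebra.QuotRing"
    "Jordan_Normal_Form.Missing_VectorSpace"
    "Jordan_Normal_Form.VS_Connect"
begin

section \<open>Sumsets and semigroups\<close>

text \<open>The set \<open>A = {a\<^sub>1 < \<dots> < a\<^sub>n}\<close> is given by its enumeration \<open>a\<close> on \<open>{1..n}\<close>; the list \<open>is\<close>
  below is \<open>i\<^sub>1 \<le> \<dots> \<le> i\<^sub>s\<close>.\<close>

definition sumset_iter :: "nat \<Rightarrow> nat \<Rightarrow> (nat \<Rightarrow> int) \<Rightarrow> int set" where
  "sumset_iter s n a = {sum_list (map a is) | is. length is = s \<and> sorted is \<and> set is \<subseteq> {1..n}}"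

inductive_set semigroup_gen :: "int set \<Rightarrow> int set" for B :: "int set" where
  zero: "0 \<in> semigroup_gen B"
| gen: "b \<in> B \<Longrightarrow> b \<in> semigroup_gen B"
| add: "x \<in> semigroup_gen B \<Longrightarrow> y \<in> semigroup_gen B \<Longrightarrow> x + y \<in> semigroup_gen B"

definition is_conductor :: "nat \<Rightarrow> int set \<Rightarrow> bool" where
  "is_conductor c \<Gamma> \<longleftrightarrow>
     (\<forall>m \<ge> int c. m \<in> \<Gamma>) \<and> (\<forall>c'::nat. (\<forall>m \<ge> int c'. m \<in> \<Gamma>) \<longrightarrow> c \<le> c')"

section \<open>Polynomials in several variables\<close>

text \<open>Monomials are exponent functions \<open>nat \<Rightarrow>\<^sub>0 nat\<close>, polynomials are finitely supported
  coefficient functions on monomials. The type has variables \<open>X\<^sub>i\<close> for all natural \<open>i\<close>;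
  \<open>polys n\<close> is \<open>k[X\<^sub>1,\<dots>,X\<^sub>n]\<close> inside it, and \<open>forms n d\<close> its homogeneous part of degree \<open>d\<close>
  (zero included).\<close>

type_synonym 'k mpoly = "(nat \<Rightarrow>\<^sub>0 nat) \<Rightarrow>\<^sub>0 'k"

definition polys :: "nat \<Rightarrow> 'k::field mpoly set" where
  "polys n = {p. \<forall>m \<in> Poly_Mapping.keys p. Poly_Mapping.keys m \<subseteq> {1..n}}"

definition forms :: "nat \<Rightarrow> nat \<Rightarrow> 'k::field mpoly set" where
  "forms n d = {p \<in> polys n. \<forall>m \<in> Poly_Mapping.keys p.
     (\<Sum>i \<in> Poly_Mapping.keys m. Poly_Mapping.lookup m i) = d}"

text \<open>The ring homomorphism that is \<open>\<phi>\<close> on coefficients and sends \<open>X\<^sub>i\<close> to \<open>x i\<close>.\<close>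

definition mpoly_subst :: "('k::field \<Rightarrow> 'b::comm_ring_1) \<Rightarrow> (nat \<Rightarrow> 'b) \<Rightarrow> 'k mpoly \<Rightarrow> 'b" where
  "mpoly_subst \<phi> x p = (\<Sum>m \<in> Poly_Mapping.keys p. \<phi> (Poly_Mapping.lookup p m) *
     (\<Prod>i \<in> Poly_Mapping.keys m. x i ^ Poly_Mapping.lookup m i))"

section \<open>The local rings of an integral projective variety\<close>

text \<open>\<open>I\<close> is a homogeneous prime ideal of \<open>k[X\<^sub>1,\<dots>,X\<^sub>n]\<close>. The function field of the variety it defines
  consists of the fractions \<open>f/g\<close> of forms of equal degree with \<open>g \<notin> I\<close>, taken modulo \<open>I\<close>.\<close>

definition hfracs :: "nat \<Rightarrow> 'k::field mpoly set \<Rightarrow> ('k mpoly \<times> 'k mpoly) set" where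
  "hfracs n I = {(f, g). \<exists>d. f \<in> forms n d \<and> g \<in> forms n d \<and> g \<notin> I}"

definition hfrac_rel ::
  "nat \<Rightarrow> 'k::field mpoly set \<Rightarrow> (('k mpoly \<times> 'k mpoly) \<times> ('k mpoly \<times> 'k mpoly)) set" where
  "hfrac_rel n I = {((f, g), (f', g')).
     (f, g) \<in> hfracs n I \<and> (f', g') \<in> hfracs n I \<and> f * g' - f' * g \<in> I}"

definition hfrac ::
  "nat \<Rightarrow> 'k::field mpoly set \<Rightarrow> 'k mpoly \<Rightarrow> 'k mpoly \<Rightarrow> ('k mpoly \<times> 'k mpoly) set" where
  "hfrac n I f g = hfrac_rel n I `` {(f, g)}"

definition function_field ::
  "nat \<Rightarrow> 'k::field mpoly set \<Rightarrow> ('k mpoly \<times> 'k mpoly) set ring" where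
  "function_field n I =
     \<lparr>carrier = hfracs n I // hfrac_rel n I,
      monoid.mult = (\<lambda>x y. \<Union>(f, g) \<in> x. \<Union>(f', g') \<in> y. hfrac n I (f * f') (g * g')),
      one = hfrac n I 1 1,
      zero = hfrac n I 0 1,
      add = (\<lambda>x y. \<Union>(f, g) \<in> x. \<Union>(f', g') \<in> y. hfrac n I (f * g' + f' * g) (g * g'))\<rparr>"

definition const_frac ::
  "nat \<Rightarrow> 'k::field mpoly set \<Rightarrow> 'k \<Rightarrow> ('k mpoly \<times> 'k mpoly) set" where
  "const_frac n I c = hfrac n I (Poly_Mapping.single 0 c) 1"

text \<open>A \<open>k\<close>-rational point is given by homogeneous coordinates \<open>P 1, \<dots>, P n\<close>.\<close>

definition local_ring ::
  "nat \<Rightarrow> 'k::field mpoly set \<Rightarrow> (nat \<Rightarrow> 'k) \<Rightarrow> ('k mpoly \<times> 'k mpoly) set set" where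
  "local_ring n I P =
     {hfrac n I f g | f g. (f, g) \<in> hfracs n I \<and> mpoly_subst (\<lambda>c. c) P g \<noteq> 0}"

section \<open>Integral closure and the delta invariant\<close>

text \<open>Integral closure of a subring \<open>S\<close> of a field \<open>L\<close> in the field of fractions of \<open>S\<close>, the latter
  being formed inside \<open>L\<close>. Polynomials over \<open>L\<close> are coefficient lists with leading coefficient first.\<close>

definition integral_over :: "('a, 'm) ring_scheme \<Rightarrow> 'a set \<Rightarrow> 'a \<Rightarrow> bool" where
  "integral_over L S x \<longleftrightarrow>
     (\<exists>p. polynomial\<^bsub>L\<^esub> S p \<and> p \<noteq> [] \<and> hd p = \<one>\<^bsub>L\<^esub> \<and> ring.eval L p x = \<zero>\<^bsub>L\<^esub>)"

definition integral_closure :: "('a, 'm) ring_scheme \<Rightarrow> 'a set \<Rightarrow> 'a set" where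
  "integral_closure L S = {x \<in> generate_field L S. integral_over L S x}"

text \<open>The quotient \<open>W / V\<close> of subspaces \<open>V \<subseteq> W\<close> of a ring \<open>L\<close> containing the scalars via \<open>\<iota>\<close>. The fields
  \<open>mult\<close> and \<open>one\<close> of the record play no role in a vector space.\<close>

definition quotient_space ::
  "('k \<Rightarrow> 'a) \<Rightarrow> ('a, 'm) ring_scheme \<Rightarrow> 'a set \<Rightarrow> 'a set \<Rightarrow> ('k, 'a set) module" where
  "quotient_space \<iota> L W V =
     \<lparr>carrier = a_rcosets\<^bsub>L\<lparr>carrier := W\<rparr>\<^esub> V,
      monoid.mult = undefined, one = undefined,
      zero = V,
      add = set_add L,
      smult = (\<lambda>c Y. V <+>\<^bsub>L\<^esub> (\<lambda>y. \<iota> c \<otimes>\<^bsub>L\<^esub> y) ` Y)\<rparr>"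

text \<open>The library's \<open>dim\<close> is a natural number, unspecified in infinite dimension.\<close>

definition vs_dim :: "('k::field, 'v) module \<Rightarrow> enat" where
  "vs_dim V = (if vectorspace.fin_dim class_ring V
     then enat (vectorspace.dim class_ring V) else \<infinity>)"

definition delta_invariant :: "nat \<Rightarrow> 'k::field mpoly set \<Rightarrow> (nat \<Rightarrow> 'k) \<Rightarrow> enat" where
  "delta_invariant n I P =
     vs_dim (quotient_space (const_frac n I) (function_field n I)
       (integral_closure (function_field n I) (local_ring n I P)) (local_ring n I P))"

section \<open>Monomial projective curves\<close>

text \<open>\<open>k[u,v]\<close> is rendered as \<open>k[u][v]\<close>, so that \<open>monom (monom 1 i) j\<close> is \<open>u\<^sup>i v\<^sup>j\<close>.\<close>

definition curve_map :: "nat \<Rightarrow> (nat \<Rightarrow> int) \<Rightarrow> 'k::field mpoly \<Rightarrow> 'k poly poly" where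
  "curve_map n a = mpoly_subst (\<lambda>c. [:[:c:]:])
     (\<lambda>i. Polynomial.monom (Polynomial.monom 1 (nat (a n - a i))) (nat (a i)))"

definition curve_ideal :: "nat \<Rightarrow> (nat \<Rightarrow> int) \<Rightarrow> 'k::field mpoly set" where
  "curve_ideal n a = {p \<in> polys n. curve_map n a p = 0}"

definition coord_point :: "nat \<Rightarrow> nat \<Rightarrow> 'k::field" where
  "coord_point j = (\<lambda>i. if i = j then 1 else 0)"

end

theory Submission
  imports Defs "HOL-Computational_Algebra.Formal_Laurent_Series" "HOL-Computational_Algebra.Polynomial_FPS"
begin

text \<open>Setting \<open>X\<^sub>1 = 1\<close> (or \<open>X\<^sub>n = 1\<close>) embeds the function field of \<open>C\<^sub>A\<close> into the Laurent series
  \<open>k((t))\<close>, with image \<open>K = k(t)\<close>. The local ring at the point is \<open>K \<inter> k[[\<Gamma>]]\<close>: a fraction that is a power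
  series has a denominator \<open>g\<close> with \<open>g(0) \<noteq> 0\<close>, and multiplying by a truncated inverse of \<open>g\<close> moves the
  denominator into \<open>1 + t\<^sup>c k[t] \<subseteq> k[\<Gamma>]\<close>. Its integral closure is \<open>K \<inter> k[[t]]\<close>. The coefficients at the gaps
  of \<open>\<Gamma>\<close> identify the quotient with \<open>k\<close> to the number of gaps. Finally \<open>0 \<in> A\<close> makes \<open>\<Gamma>\<^sub>1\<close> the set of
  integers that lie in \<open>sA\<close> for all large \<open>s\<close>, and \<open>x \<mapsto> s a\<^sub>n - x\<close> exchanges the two points.\<close>

section \<open>Quotients inside a model of a field\<close>

text \<open>Local ring and integral closure must be compared inside one ambient field in which
  denominators can be changed and single coefficients can be read. Laurent series offer this: k((t))
  contains both k(t) and k[[t]], its coefficient maps are linear, and a pole shows as a negative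
  order. The function field is a record of equivalence classes of pairs of forms, so the algebra is
  done in k((t)) and carried back along a bijection. The fact behind the main steps is that \<Gamma>
  has finitely many gaps. From the conductor c on every exponent is available, so multiplying
  numerator and denominator by t^c turns any fraction of polynomials into one over k[\<Gamma>]; this
  is why K is all of k(t) and why the local ring has K as its field of fractions. The finiteness
  itself is extracted from the sumset formula: as s grows, the reflected part moves past any given
  integer, and what remains is a finite set followed by all integers from some point on.\<close>

lemma vs_dim_eq_card_support:
  fixes Q :: "('k::field, 'v) module" and T :: "('i \<Rightarrow> 'k) \<Rightarrow> 'v" and G :: "'i set"
  defines "V \<equiv> {f. \<forall>i. i \<notin> G \<longrightarrow> f i = 0}"
  assumes fin: "finite G" and car: "carrier Q = T ` V" and inj: "inj_on T V"
    and add: "\<And>f g. f \<in> V \<Longrightarrow> g \<in> V \<Longrightarrow> T f \<oplus>\<^bsub>Q\<^esub> T g = T (\<lambda>i. f i + g i)"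
    and zero: "\<zero>\<^bsub>Q\<^esub> = T (\<lambda>_. 0)"
    and smult: "\<And>c f. f \<in> V \<Longrightarrow> c \<odot>\<^bsub>Q\<^esub> T f = T (\<lambda>i. c * f i)"
  shows "vs_dim Q = enat (card G)"
proof -
  have V0: "(\<lambda>_. 0) \<in> V" and Vadd: "\<And>f g. f \<in> V \<Longrightarrow> g \<in> V \<Longrightarrow> (\<lambda>i. f i + g i) \<in> V"
    and Vsc: "\<And>c f. f \<in> V \<Longrightarrow> (\<lambda>i. c * f i) \<in> V" and Vum: "\<And>f. f \<in> V \<Longrightarrow> (\<lambda>i. - f i) \<in> V"
    by (auto simp: V_def)
  have ag: "abelian_group Q"
  proof (rule abelian_groupI)
    fix x assume "x \<in> carrier Q"
    then obtain f where f: "f \<in> V" "x = T f" by (auto simp: car)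
    then show "\<exists>y\<in>carrier Q. y \<oplus>\<^bsub>Q\<^esub> x = \<zero>\<^bsub>Q\<^esub>"
      by (intro bexI[where x = "T (\<lambda>i. - f i)"]) (simp_all add: car add zero Vum)
  qed (auto simp: car add zero V0 Vadd ac_simps intro!: imageI)
  have mod: "module class_ring Q"
    by (rule moduleI)
       (auto simp: car add zero smult V0 Vadd Vsc ag algebra_simps class_cring.is_cring
         intro!: imageI arg_cong[where f = T])
  interpret Q: vectorspace class_ring Q
    by (rule vectorspace.intro[OF mod class_field.field_axioms])
  define e where "e j = T (\<lambda>i. if i = j then 1 else 0)" for j
  have eV: "(\<lambda>i. if i = j then 1 else 0) \<in> V" if "j \<in> G" for j
    using that by (auto simp: V_def)
  have e_inj: "inj_on e G"
  proof (rule inj_onI)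
    fix j l assume "j \<in> G" "l \<in> G" "e j = e l"
    then have "(\<lambda>i. if i = j then 1 else 0 :: 'k) = (\<lambda>i. if i = l then 1 else 0)"
      using inj eV unfolding e_def by (meson inj_onD)
    then show "j = l" by (metis zero_neq_one)
  qed
  have eC: "e ` G \<subseteq> carrier Q" using eV by (auto simp: e_def car)
  have VI: "(\<lambda>i. if i \<in> Y then g i else 0) \<in> V" if "Y \<subseteq> G" for Y g
    using that by (auto simp: V_def)
  have fs: "finsum Q (\<lambda>j. g j \<odot>\<^bsub>Q\<^esub> e j) Y = T (\<lambda>i. if i \<in> Y then g i else 0)" if "Y \<subseteq> G" for Y g
    using finite_subset[OF that fin] that
  proof (induction Y rule: finite_induct)
    case empty
    then show ?case by (simp add: zero)
  next
    case (insert j Y)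
    then have j: "j \<in> G" and Y: "Y \<subseteq> G" by auto
    have c: "g l \<odot>\<^bsub>Q\<^esub> e l \<in> carrier Q" if "l \<in> G" for l
      using that eC by (intro Q.smult_closed) auto
    have "finsum Q (\<lambda>l. g l \<odot>\<^bsub>Q\<^esub> e l) (insert j Y) = g j \<odot>\<^bsub>Q\<^esub> e j \<oplus>\<^bsub>Q\<^esub> finsum Q (\<lambda>l. g l \<odot>\<^bsub>Q\<^esub> e l) Y"
      using insert.hyps c j Y by (intro Q.finsum_insert) auto
    also have "\<dots> = T (\<lambda>i. g j * (if i = j then 1 else 0)) \<oplus>\<^bsub>Q\<^esub> T (\<lambda>i. if i \<in> Y then g i else 0)"
      using insert.IH[OF Y] eV[OF j] by (simp add: e_def smult)
    also have "\<dots> = T (\<lambda>i. g j * (if i = j then 1 else 0) + (if i \<in> Y then g i else 0))"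
      by (rule add[OF Vsc[OF eV[OF j]] VI[OF Y]])
    also have "\<dots> = T (\<lambda>i. if i \<in> insert j Y then g i else 0)"
      using insert.hyps by (intro arg_cong[where f = T]) auto
    finally show ?case .
  qed
  have lc: "Q.lincomb g (e ` G) = T (\<lambda>i. if i \<in> G then g (e i) else 0)" for g
  proof -
    have "Q.lincomb g (e ` G) = finsum Q (\<lambda>v. g v \<odot>\<^bsub>Q\<^esub> v) (e ` G)" by (simp add: Q.lincomb_def)
    also have "\<dots> = finsum Q (\<lambda>j. g (e j) \<odot>\<^bsub>Q\<^esub> e j) G"
      by (rule Q.finsum_reindex[OF _ e_inj]) (use eC in \<open>auto intro!: Q.smult_closed\<close>)
    also have "\<dots> = T (\<lambda>i. if i \<in> G then g (e i) else 0)"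
      by (rule fs[OF subset_refl])
    finally show ?thesis .
  qed
  have gen: "Q.span (e ` G) = carrier Q"
  proof
    show "Q.span (e ` G) \<subseteq> carrier Q" by (rule Q.span_is_subset2[OF eC])
    show "carrier Q \<subseteq> Q.span (e ` G)"
    proof
      fix v assume "v \<in> carrier Q"
      then obtain f where f: "f \<in> V" "v = T f" by (auto simp: car)
      \<comment> \<open>Coefficients of \<open>lincomb\<close> are indexed by vectors, so the
        coordinate function is pulled back along the inverse of \<open>e\<close>.\<close>
      have "Q.lincomb (f \<circ> inv_into G e) (e ` G) = T (\<lambda>i. if i \<in> G then f i else 0)"
        unfolding lc by (intro arg_cong[where f = T]) (auto simp: inv_into_f_f[OF e_inj])
      also have "(\<lambda>i. if i \<in> G then f i else 0) = f" using f by (auto simp: V_def)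
      finally have "v = Q.lincomb (f \<circ> inv_into G e) (e ` G)" using f(2) by (simp only:)
      then show "v \<in> Q.span (e ` G)" unfolding Q.span_def using fin by auto
    qed
  qed
  have li: "Q.lin_indpt (e ` G)"
  proof (rule Q.finite_lin_indpt2)
    fix g assume "Q.lincomb g (e ` G) = \<zero>\<^bsub>Q\<^esub>"
    then have "(\<lambda>i. if i \<in> G then g (e i) else 0) = (\<lambda>_. 0)"
      unfolding lc zero by (rule inj_onD[OF inj]) (simp_all add: VI V0)
    then show "\<forall>v\<in>e ` G. g v = \<zero>\<^bsub>class_ring\<^esub>" by (auto dest: fun_cong split: if_splits)
  qed (use fin eC in auto)
  have "Q.dim = card (e ` G)"
    by (rule Q.dim_basis) (use fin li gen eC in \<open>auto simp: Q.basis_def\<close>)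
  moreover have "Q.fin_dim" unfolding Q.fin_dim_def using fin gen eC by blast
  ultimately show ?thesis by (simp add: vs_dim_def card_image[OF e_inj])
qed

text \<open>A record of equivalence classes is awkward for arithmetic. \<open>F\<close> identifies
  it with a subset \<open>K\<close> of a field type, closed under the field operations, where the
  simplifier can compute; the field axioms of \<open>L\<close> then follow by transport.\<close>

locale field_model =
  fixes L :: "('a, 'm) ring_scheme" (structure) and F :: "'b::field \<Rightarrow> 'a" and K :: "'b set"
  assumes K_one: "1 \<in> K" and K_add: "\<And>x y. x \<in> K \<Longrightarrow> y \<in> K \<Longrightarrow> x + y \<in> K"
    and K_mult: "\<And>x y. x \<in> K \<Longrightarrow> y \<in> K \<Longrightarrow> x * y \<in> K"
    and K_uminus: "\<And>x. x \<in> K \<Longrightarrow> - x \<in> K" and K_inverse: "\<And>x. x \<in> K \<Longrightarrow> inverse x \<in> K"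
    and carrier_eq: "carrier L = F ` K" and inj: "inj_on F K"
    and mult_F: "\<And>x y. x \<in> K \<Longrightarrow> y \<in> K \<Longrightarrow> F x \<otimes> F y = F (x * y)"
    and add_F: "\<And>x y. x \<in> K \<Longrightarrow> y \<in> K \<Longrightarrow> F x \<oplus> F y = F (x + y)"
    and one_F: "\<one> = F 1" and zero_F: "\<zero> = F 0"
begin

lemma K_zero: "0 \<in> K"
  using K_add[OF K_one K_uminus[OF K_one]] by simp

lemma K_power: "x \<in> K \<Longrightarrow> x ^ m \<in> K"
  by (induction m) (auto intro: K_one K_mult)

lemma F_eq_iff: "x \<in> K \<Longrightarrow> y \<in> K \<Longrightarrow> F x = F y \<longleftrightarrow> x = y"
  using inj by (auto dest: inj_onD)

lemma is_field: "field L"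
proof -
  have ag: "abelian_group L"
  proof (rule abelian_groupI)
    fix x assume "x \<in> carrier L"
    then obtain z where z: "z \<in> K" "x = F z" by (auto simp: carrier_eq)
    then show "\<exists>y\<in>carrier L. y \<oplus> x = \<zero>"
      by (intro bexI[where x = "F (- z)"]) (simp_all add: carrier_eq add_F zero_F K_uminus)
  qed (auto simp: carrier_eq add_F zero_F K_zero K_add ac_simps intro!: imageI)
  have cm: "comm_monoid L"
    by (rule comm_monoidI)
       (auto simp: carrier_eq mult_F one_F K_one K_mult ac_simps)
  interpret cring L
    by (rule cringI[OF ag cm]) (auto simp: carrier_eq mult_F add_F K_add K_mult algebra_simps)
  show ?thesis
  proof (rule cring_fieldI2)
    show "\<zero> \<noteq> \<one>" by (simp add: zero_F one_F F_eq_iff K_zero K_one)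
    fix x assume "x \<in> carrier L" "x \<noteq> \<zero>"
    then obtain z where z: "z \<in> K" "x = F z" "z \<noteq> 0" by (auto simp: carrier_eq zero_F)
    then show "\<exists>y\<in>carrier L. x \<otimes> y = \<one>"
      by (intro bexI[where x = "F (inverse z)"]) (auto simp: carrier_eq one_F mult_F K_inverse)
  qed
qed

sublocale field L by (rule is_field)

lemma power_F: "x \<in> K \<Longrightarrow> F x [^] (m::nat) = F (x ^ m)"
  by (induction m) (auto simp: one_F mult_F K_power mult.commute)

lemma inv_F: "x \<in> K \<Longrightarrow> x \<noteq> 0 \<Longrightarrow> inv (F x) = F (inverse x)"
  by (rule comm_inv_char) (auto simp: carrier_eq mult_F one_F K_inverse)

lemma poly_Poly_in_K: "set zs \<subseteq> K \<Longrightarrow> x \<in> K \<Longrightarrow> poly (Poly zs) x \<in> K"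
  by (induction zs) (auto intro: K_zero K_add K_mult)

text \<open>The reversal reconciles two conventions: the lists evaluated in \<open>L\<close> start
  with the leading coefficient, those given to \<open>Poly\<close> with the constant one.\<close>

lemma eval_map_F:
  "set zs \<subseteq> K \<Longrightarrow> x \<in> K \<Longrightarrow> eval (map F zs) (F x) = F (poly (Poly (rev zs)) x)"
proof (induction zs)
  case Nil
  then show ?case by (simp add: zero_F)
next
  case (Cons z zs)
  then show ?case
    by (simp add: Poly_snoc poly_monom power_F mult_F add_F K_mult K_power poly_Poly_in_K add.commute)
qed

text \<open>Injectivity of \<open>F\<close> carries the leading one and the vanishing value back and
  forth. The set \<open>S\<close> has to contain 0 because \<open>coeff\<close> returns 0 beyond the
  degree.\<close>

lemma integral_over_F_iff:
  assumes S: "S \<subseteq> K" "0 \<in> S" and x: "x \<in> K"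
  shows "integral_over L (F ` S) (F x) \<longleftrightarrow>
    (\<exists>q. Polynomial.coeff q (Polynomial.degree q) = 1 \<and> (\<forall>i. Polynomial.coeff q i \<in> S) \<and> poly q x = 0)"
proof
  assume "integral_over L (F ` S) (F x)"
  then obtain p where p: "polynomial\<^bsub>L\<^esub> (F ` S) p" "p \<noteq> []" "hd p = \<one>" "eval p (F x) = \<zero>"
    by (auto simp: integral_over_def)
  then have "p \<in> lists (F ` S)" by (auto simp: polynomial_def)
  then obtain zs where zs: "set zs \<subseteq> S" "p = map F zs"
    unfolding lists_image by auto
  then obtain z ys where ys: "zs = z # ys" using p by (cases zs) auto
  have "z = 1" using p zs ys S by (auto simp: one_F F_eq_iff K_one)
  define q where "q = Poly (rev zs)"
  have cq: "Polynomial.coeff q i = nth_default 0 (rev zs) i" for i by (simp add: q_def)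
  have "Polynomial.coeff q (length ys) = 1" using ys \<open>z = 1\<close>
    by (simp add: cq nth_default_def nth_append)
  moreover have "Polynomial.degree q \<le> length ys"
    by (rule degree_le) (auto simp: cq nth_default_def ys)
  ultimately have "Polynomial.coeff q (Polynomial.degree q) = 1"
    by (metis le_degree le_antisym zero_neq_one)
  moreover have "Polynomial.coeff q i \<in> S" for i
    unfolding cq nth_default_def using zs S
    by (metis in_mono length_rev nth_mem set_rev)
  moreover have "F (poly q x) = F 0"
    using p(4) zs S x by (simp add: eval_map_F q_def zero_F)
  then have "poly q x = 0"
    using zs S x by (subst (asm) F_eq_iff) (auto simp: q_def K_zero intro!: poly_Poly_in_K)
  ultimately show "\<exists>q. Polynomial.coeff q (Polynomial.degree q) = 1 \<and> (\<forall>i. Polynomial.coeff q i \<in> S) \<and> poly q x = 0" by blast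
next
  assume "\<exists>q. Polynomial.coeff q (Polynomial.degree q) = 1 \<and> (\<forall>i. Polynomial.coeff q i \<in> S) \<and> poly q x = 0"
  then obtain q where q: "Polynomial.coeff q (Polynomial.degree q) = 1" "\<And>i. Polynomial.coeff q i \<in> S" "poly q x = 0" by blast
  define zs where "zs = rev (coeffs q)"
  have "q \<noteq> 0" using q(1) by auto
  moreover have "1 \<in> S" using q(1) q(2)[of "Polynomial.degree q"] by simp
  ultimately have zs: "zs \<noteq> []" "hd zs = 1" "set zs \<subseteq> S"
    using q by (auto simp: zs_def hd_rev last_coeffs_eq_coeff_degree coeffs_def)
  have "hd (map F zs) = \<one>" using zs by (simp add: hd_map one_F)
  moreover have "eval (map F zs) (F x) = \<zero>"
    using zs S x q(3) by (subst eval_map_F) (auto simp: zs_def zero_F)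
  ultimately show "integral_over L (F ` S) (F x)"
    unfolding integral_over_def polynomial_def using zs
    by (intro exI[where x = "map F zs"]) auto
qed

text \<open>Integral closure is formed in the field of fractions of \<open>S\<close> inside
  \<open>L\<close>; under this criterion that field is all of \<open>L\<close>, and the restriction
  disappears.\<close>

lemma generate_field_eq_carrier:
  assumes S: "S \<subseteq> K" and frac: "\<And>x. x \<in> K \<Longrightarrow> \<exists>y\<in>S. \<exists>z\<in>S. z \<noteq> 0 \<and> x = y / z"
  shows "generate_field L (F ` S) = carrier L"
proof
  show "generate_field L (F ` S) \<subseteq> carrier L"
    using S by (intro generate_field_incl) (auto simp: carrier_eq)
  show "carrier L \<subseteq> generate_field L (F ` S)"
  proof
    fix v assume "v \<in> carrier L"
    then obtain x where "x \<in> K" "v = F x" by (auto simp: carrier_eq)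
    with frac obtain y z where yz: "y \<in> S" "z \<in> S" "z \<noteq> 0" "x = y / z" by blast
    then have K: "y \<in> K" "z \<in> K" using S by auto
    have "v = F y \<otimes> inv (F z)"
      using \<open>v = F x\<close> yz K by (simp add: inv_F mult_F K_inverse divide_inverse)
    moreover have "F z \<noteq> \<zero>" using yz K by (simp add: zero_F F_eq_iff K_zero)
    ultimately show "v \<in> generate_field L (F ` S)"
      using yz by (simp add: generate_field.eng_mult generate_field.m_inv generate_field.incl)
  qed
qed

text \<open>The cosets of the kernel of \<open>\<tau>\<close> are its fibres, so \<open>W / V\<close> is the image of \<open>\<tau>\<close>.\<close>

lemma vs_dim_quotient_space:
  fixes \<iota> :: "'k::field \<Rightarrow> 'a" and \<kappa> :: "'k \<Rightarrow> 'b" and \<tau> :: "'b \<Rightarrow> 'i \<Rightarrow> 'k"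
  assumes fin: "finite G" and W: "W \<subseteq> K" and Wadd: "\<And>x y. x \<in> W \<Longrightarrow> y \<in> W \<Longrightarrow> x + y \<in> W"
    and Wsc: "\<And>c x. x \<in> W \<Longrightarrow> \<kappa> c * x \<in> W" and kK: "\<And>c. \<kappa> c \<in> K"
    and Wum: "\<And>x. x \<in> W \<Longrightarrow> - x \<in> W" and W0: "0 \<in> W"
    and iota: "\<And>c. \<iota> c = F (\<kappa> c)"
    and tadd: "\<And>x y. x \<in> W \<Longrightarrow> y \<in> W \<Longrightarrow> \<tau> (x + y) = (\<lambda>i. \<tau> x i + \<tau> y i)"
    and tsc: "\<And>c x. x \<in> W \<Longrightarrow> \<tau> (\<kappa> c * x) = (\<lambda>i. c * \<tau> x i)"
    and im: "\<tau> ` W = {f. \<forall>i. i \<notin> G \<longrightarrow> f i = 0}"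
  shows "vs_dim (quotient_space \<iota> L (F ` W) (F ` {x \<in> W. \<tau> x = (\<lambda>_. 0)})) = enat (card G)"
proof -
  define T where "T f = F ` {x \<in> W. \<tau> x = f}" for f
  define V where "V = {x \<in> W. \<tau> x = (\<lambda>_. 0)}"
  let ?U = "{f :: 'i \<Rightarrow> 'k. \<forall>i. i \<notin> G \<longrightarrow> f i = 0}"
  \<comment> \<open>Only additivity of \<open>\<tau>\<close> is given; its value at 0, and from that
    its behaviour under negation, are derived.\<close>
  have um: "\<tau> (- x) = (\<lambda>i. - \<tau> x i)" if "x \<in> W" for x
  proof
    fix i
    have "\<tau> 0 i = \<tau> 0 i + \<tau> 0 i" using tadd[OF W0 W0] by (metis add_0)
    then have "\<tau> 0 i = 0" by (metis add_cancel_left_left)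
    moreover have "\<tau> 0 i = \<tau> x i + \<tau> (- x) i" using tadd[OF that Wum[OF that]] by (simp add: fun_eq_iff)
    ultimately show "\<tau> (- x) i = - \<tau> x i" by (simp add: eq_neg_iff_add_eq_0 add.commute)
  qed
  have add: "T f <+>\<^bsub>L\<^esub> T g = T (\<lambda>i. f i + g i)" if fg: "f \<in> ?U" "g \<in> ?U" for f g
  proof (intro equalityI subsetI)
    fix v assume "v \<in> T f <+>\<^bsub>L\<^esub> T g"
    then obtain x y where "x \<in> W" "y \<in> W" "\<tau> x = f" "\<tau> y = g" "v = F x \<oplus> F y"
      by (auto simp: set_add_def' T_def)
    then show "v \<in> T (\<lambda>i. f i + g i)"
      using W by (auto simp: T_def add_F tadd Wadd subset_iff intro!: imageI)
  next
    fix v assume "v \<in> T (\<lambda>i. f i + g i)"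
    then obtain z where z: "z \<in> W" "\<tau> z = (\<lambda>i. f i + g i)" "v = F z" by (auto simp: T_def)
    \<comment> \<open>Surjectivity of \<open>\<tau>\<close> supplies a point over \<open>f\<close>;
      the difference from \<open>z\<close> then automatically lies over \<open>g\<close>.\<close>
    from fg im obtain x where x: "x \<in> W" "\<tau> x = f" by (metis (lifting) imageE)
    have y: "- x + z \<in> W" using x z by (intro Wadd Wum)
    have "\<tau> (- x + z) = g" using x z by (subst tadd) (auto simp: Wum um)
    moreover have "v = F x \<oplus> F (- x + z)" using x y z W by (subst add_F) auto
    ultimately show "v \<in> T f <+>\<^bsub>L\<^esub> T g"
      using x y by (auto simp: set_add_def' T_def)
  qed
  have V0: "F ` V = T (\<lambda>_. 0)" by (simp add: V_def T_def)
  have coset: "F ` V +>\<^bsub>L\<lparr>carrier := F ` W\<rparr>\<^esub> F x = T (\<tau> x)" if x: "x \<in> W" for x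
  proof (intro equalityI subsetI)
    fix v assume "v \<in> F ` V +>\<^bsub>L\<lparr>carrier := F ` W\<rparr>\<^esub> F x"
    then obtain y where "y \<in> W" "\<tau> y = (\<lambda>_. 0)" "v = F y \<oplus> F x"
      by (auto simp: a_r_coset_def' V_def)
    then show "v \<in> T (\<tau> x)" using x W by (auto simp: T_def add_F tadd Wadd subset_iff intro!: imageI)
  next
    fix v assume "v \<in> T (\<tau> x)"
    then obtain z where z: "z \<in> W" "\<tau> z = \<tau> x" "v = F z" by (auto simp: T_def)
    have y: "z + - x \<in> W" using x z by (intro Wadd Wum)
    have "\<tau> (z + - x) = (\<lambda>_. 0)" using x z by (subst tadd) (auto simp: Wum um)
    moreover have "v = F (z + - x) \<oplus> F x" using x y z W by (subst add_F) auto
    ultimately show "v \<in> F ` V +>\<^bsub>L\<lparr>carrier := F ` W\<rparr>\<^esub> F x"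
      using x y by (auto simp: a_r_coset_def' V_def)
  qed
  \<comment> \<open>Scaling need not send a fibre onto a fibre: with constant series as scalars, c =
    0 collapses it to a point. Adding the kernel restores the whole fibre.\<close>
  have smult: "F ` V <+>\<^bsub>L\<^esub> (\<lambda>v. \<iota> c \<otimes> v) ` T f = T (\<lambda>i. c * f i)" if f: "f \<in> ?U" for c f
  proof (intro equalityI subsetI)
    fix v assume "v \<in> F ` V <+>\<^bsub>L\<^esub> (\<lambda>v. \<iota> c \<otimes> v) ` T f"
    then obtain x y where "x \<in> W" "\<tau> x = (\<lambda>_. 0)" "y \<in> W" "\<tau> y = f" "v = F x \<oplus> (\<iota> c \<otimes> F y)"
      by (auto simp: set_add_def' T_def V_def)
    then show "v \<in> T (\<lambda>i. c * f i)"
      using W kK by (auto simp: T_def add_F mult_F iota tadd tsc Wadd Wsc K_mult subset_iff intro!: imageI)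
  next
    fix v assume "v \<in> T (\<lambda>i. c * f i)"
    then obtain z where z: "z \<in> W" "\<tau> z = (\<lambda>i. c * f i)" "v = F z" by (auto simp: T_def)
    from f im obtain y where y: "y \<in> W" "\<tau> y = f" by (metis (lifting) imageE)
    have x: "z + - (\<kappa> c * y) \<in> W" using y z by (intro Wadd Wum Wsc)
    have "\<tau> (z + - (\<kappa> c * y)) = (\<lambda>_. 0)" using y z
      by (subst tadd) (auto simp: Wum um Wsc tsc)
    moreover have "v = F (z + - (\<kappa> c * y)) \<oplus> (\<iota> c \<otimes> F y)"
      using x y z W kK by (simp add: iota mult_F add_F K_mult subset_iff)
    ultimately show "v \<in> F ` V <+>\<^bsub>L\<^esub> (\<lambda>v. \<iota> c \<otimes> v) ` T f"
      using x y unfolding set_add_def' T_def V_def by blast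
  qed
  show ?thesis
  proof (rule vs_dim_eq_card_support[where T = T])
    have "carrier (quotient_space \<iota> L (F ` W) (F ` V)) = (\<lambda>x. T (\<tau> x)) ` W"
      by (auto simp: quotient_space_def A_RCOSETS_def' coset)
    then show "carrier (quotient_space \<iota> L (F ` W) (F ` {x \<in> W. \<tau> x = (\<lambda>_. 0)})) = T ` ?U"
      by (simp add: V_def im[symmetric] image_image)
    show "inj_on T ?U"
    proof (rule inj_onI)
      fix f g assume fg: "f \<in> ?U" "g \<in> ?U" "T f = T g"
      from fg im obtain x where x: "x \<in> W" "\<tau> x = f" by (metis (lifting) imageE)
      then have "F x \<in> T g" using fg by (auto simp: T_def)
      then obtain y where "y \<in> W" "\<tau> y = g" "F x = F y" by (auto simp: T_def)
      moreover from this have "x = y" using x W by (subst (asm) F_eq_iff) auto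
      ultimately show "f = g" using x by simp
    qed
  qed (use fin add smult V0 in \<open>auto simp: quotient_space_def V_def\<close>)
qed

end

section \<open>Dehomogenization\<close>

text \<open>The exponent of t in the image of a monomial under X_i -> t^(w i). The constant weight 1
  gives the total degree.\<close>

definition weight :: "(nat \<Rightarrow> nat) \<Rightarrow> (nat \<Rightarrow>\<^sub>0 nat) \<Rightarrow> nat" where
  "weight w m = (\<Sum>i\<in>Poly_Mapping.keys m. w i * Poly_Mapping.lookup m i)"

text \<open>The ring homomorphism X_i -> t^(w i) to k[t]. A variable of weight 0 becomes 1, which is
  dehomogenization followed by the monomial parametrization of the chart.\<close>

definition dehom :: "(nat \<Rightarrow> nat) \<Rightarrow> 'k::field mpoly \<Rightarrow> 'k poly" where
  "dehom w p = (\<Sum>m\<in>Poly_Mapping.keys p. Polynomial.monom (Poly_Mapping.lookup p m) (weight w m))"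

lemma weight_superset:
  "finite A \<Longrightarrow> Poly_Mapping.keys m \<subseteq> A \<Longrightarrow> weight w m = (\<Sum>i\<in>A. w i * Poly_Mapping.lookup m i)"
  unfolding weight_def by (rule sum.mono_neutral_left) (auto simp: in_keys_iff)

lemma weight_add: "weight w (m + m') = weight w m + weight w m'"
proof -
  let ?A = "Poly_Mapping.keys m \<union> Poly_Mapping.keys m'"
  have "Poly_Mapping.keys (m + m') \<subseteq> ?A" by (rule Poly_Mapping.keys_add)
  then show ?thesis
    by (subst (1 2 3) weight_superset[of ?A])
       (auto simp: lookup_add algebra_simps sum.distrib)
qed

lemma weight_single [simp]: "weight w (Poly_Mapping.single i c) = w i * c"
  by (simp add: weight_def)

lemma weight_zero [simp]: "weight w 0 = 0"
  by (simp add: weight_def)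

text \<open>Keys may cancel in a sum of polynomials; a common finite index set lets additivity be
  checked term by term.\<close>

lemma dehom_superset:
  "finite A \<Longrightarrow> Poly_Mapping.keys p \<subseteq> A \<Longrightarrow>
    dehom w p = (\<Sum>m\<in>A. Polynomial.monom (Poly_Mapping.lookup p m) (weight w m))"
  unfolding dehom_def by (rule sum.mono_neutral_left) (auto simp: in_keys_iff)

lemma dehom_add: "dehom w (p + q) = dehom w p + dehom w q"
proof -
  let ?A = "Poly_Mapping.keys p \<union> Poly_Mapping.keys q"
  have "Poly_Mapping.keys (p + q) \<subseteq> ?A" by (rule Poly_Mapping.keys_add)
  then show ?thesis
    by (subst (1 2 3) dehom_superset[of ?A])
       (auto simp: lookup_add add_monom[symmetric] sum.distrib)
qed

lemma dehom_single [simp]: "dehom w (Poly_Mapping.single m c) = Polynomial.monom c (weight w m)"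
  by (simp add: dehom_def)

lemma dehom_zero [simp]: "dehom w 0 = 0"
  by (simp add: dehom_def)

lemma dehom_one [simp]: "dehom w 1 = 1"
  using dehom_single[of w 0 1] by (simp add: monom_0 one_pCons del: dehom_single)

lemma dehom_uminus: "dehom w (- p) = - dehom w p"
  using dehom_add[of w p "- p"] by (simp add: eq_neg_iff_add_eq_0 add.commute)

lemma dehom_diff: "dehom w (p - q) = dehom w p - dehom w q"
  using dehom_add[of w p "- q"] by (simp add: dehom_uminus)

lemma dehom_sum: "dehom w (\<Sum>i\<in>A. p i) = (\<Sum>i\<in>A. dehom w (p i))"
  by (induction A rule: infinite_finite_induct) (auto simp: dehom_add)

lemma mpoly_eq_sum_single:
  "p = (\<Sum>m\<in>Poly_Mapping.keys p. Poly_Mapping.single m (Poly_Mapping.lookup p m))"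
  by (rule poly_mapping_eqI)
     (auto simp: lookup_sum lookup_single when_def in_keys_iff sum.delta)

lemma dehom_mult: "dehom w (p * q) = dehom w p * dehom w q"
proof -
  have "p * q = (\<Sum>m\<in>Poly_Mapping.keys p. \<Sum>m'\<in>Poly_Mapping.keys q.
      Poly_Mapping.single (m + m') (Poly_Mapping.lookup p m * Poly_Mapping.lookup q m'))"
    by (subst mpoly_eq_sum_single[of p], subst mpoly_eq_sum_single[of q])
       (simp only: sum_product mult_single)
  then show ?thesis
    by (simp add: dehom_sum weight_add mult_monom[symmetric]) (simp add: dehom_def sum_product)
qed

lemma coeff_dehom:
  "Polynomial.coeff (dehom w p) e =
    (\<Sum>m\<in>Poly_Mapping.keys p. if weight w m = e then Poly_Mapping.lookup p m else 0)"
  by (simp add: dehom_def coeff_sum)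

section \<open>Forms, and their values at a coordinate point\<close>

lemma mem_polys_iff: "p \<in> polys n \<longleftrightarrow> (\<forall>m\<in>Poly_Mapping.keys p. Poly_Mapping.keys m \<subseteq> {1..n})"
  by (simp add: polys_def)

lemma mem_forms_iff:
  "p \<in> forms n d \<longleftrightarrow>
    (\<forall>m\<in>Poly_Mapping.keys p. Poly_Mapping.keys m \<subseteq> {1..n} \<and> weight (\<lambda>_. 1) m = d)"
  by (auto simp: forms_def polys_def weight_def)

lemma forms_zero: "0 \<in> forms n d"
  by (simp add: mem_forms_iff)

lemma forms_one: "1 \<in> forms n 0"
  by (simp add: mem_forms_iff)

lemma forms_single:
  "Poly_Mapping.keys m \<subseteq> {1..n} \<Longrightarrow> Poly_Mapping.single m c \<in> forms n (weight (\<lambda>_. 1) m)"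
  by (simp add: mem_forms_iff)

lemma forms_add: "p \<in> forms n d \<Longrightarrow> q \<in> forms n d \<Longrightarrow> p + q \<in> forms n d"
  using Poly_Mapping.keys_add[of p q] unfolding mem_forms_iff by blast

lemma forms_uminus: "p \<in> forms n d \<Longrightarrow> - p \<in> forms n d"
  by (simp add: mem_forms_iff)

lemma forms_diff: "p \<in> forms n d \<Longrightarrow> q \<in> forms n d \<Longrightarrow> p - q \<in> forms n d"
  using forms_add[of p n d "- q"] by (simp add: forms_uminus)

lemma forms_mult:
  assumes "p \<in> forms n d" "q \<in> forms n d'"
  shows "p * q \<in> forms n (d + d')"
  unfolding mem_forms_iff
proof
  fix m assume "m \<in> Poly_Mapping.keys (p * q)"
  then obtain a b where ab: "a \<in> Poly_Mapping.keys p" "b \<in> Poly_Mapping.keys q" "m = a + b"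
    using keys_mult[of p q] by blast
  have "Poly_Mapping.keys (a + b) \<subseteq> Poly_Mapping.keys a \<union> Poly_Mapping.keys b"
    by (rule Poly_Mapping.keys_add)
  then show "Poly_Mapping.keys m \<subseteq> {1..n} \<and> weight (\<lambda>_. 1) m = d + d'"
    using ab assms by (auto simp: mem_forms_iff weight_add)
qed

text \<open>A monomial is nonzero at the coordinate point exactly when it is a power of X_j, and
  since all other weights are positive these are the monomials of weight 0. Evaluation at the point
  thus becomes evaluation at t = 0.\<close>

lemma mpoly_subst_coord_point:
  assumes g: "g \<in> polys n" and wj: "w j = 0" and wpos: "\<And>i. i \<in> {1..n} \<Longrightarrow> i \<noteq> j \<Longrightarrow> w i > 0"
  shows "mpoly_subst (\<lambda>c. c) (coord_point j) g = Polynomial.coeff (dehom w g) 0"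
  unfolding mpoly_subst_def coeff_dehom
proof (rule sum.cong[OF refl])
  fix m assume m: "m \<in> Poly_Mapping.keys g"
  let ?P = "\<Prod>i\<in>Poly_Mapping.keys m. coord_point j i ^ Poly_Mapping.lookup m i :: 'a"
  have "?P = (if weight w m = 0 then 1 else 0)"
  proof (cases "weight w m = 0")
    case True
    have "i = j" if i: "i \<in> Poly_Mapping.keys m" for i
    proof (rule ccontr)
      assume "i \<noteq> j"
      moreover have "i \<in> {1..n}" using i m g unfolding mem_polys_iff by blast
      moreover have "w i * Poly_Mapping.lookup m i = 0"
        using True i by (auto simp: weight_def sum_eq_0_iff)
      ultimately show False using wpos[of i] i by (auto simp: in_keys_iff)
    qed
    then have "?P = 1" by (intro prod.neutral) (auto simp: coord_point_def)
    then show ?thesis using True by simp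
  next
    case False
    then obtain i where i: "i \<in> Poly_Mapping.keys m" "w i * Poly_Mapping.lookup m i \<noteq> 0"
      unfolding weight_def by (metis (no_types, lifting) sum.neutral)
    then have "i \<noteq> j" using wj by auto
    then have "coord_point j i ^ Poly_Mapping.lookup m i = (0::'a)"
      using i by (auto simp: coord_point_def in_keys_iff)
    then have "?P = 0" using i by (intro prod_zero) auto
    then show ?thesis using False by simp
  qed
  then show "Poly_Mapping.lookup g m * ?P = (if weight w m = 0 then Poly_Mapping.lookup g m else 0)"
    by simp
qed

section \<open>Homogeneous elements of the curve ideal\<close>

lemma curve_map_eq:
  assumes "p \<in> polys n"
  shows "curve_map n a p = (\<Sum>m\<in>Poly_Mapping.keys p.
    Polynomial.monom (Polynomial.monom (Poly_Mapping.lookup p m)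
      (weight (\<lambda>i. nat (a n - a i)) m)) (weight (\<lambda>i. nat (a i)) m))"
  unfolding curve_map_def mpoly_subst_def
proof (rule sum.cong[OF refl])
  fix m
  let ?u = "\<lambda>i. nat (a n - a i)" and ?v = "\<lambda>i. nat (a i)"
  have "(\<Prod>i\<in>A. Polynomial.monom (Polynomial.monom 1 (?u i)) (?v i) ^ l i) =
      Polynomial.monom (Polynomial.monom (1::'a) (\<Sum>i\<in>A. ?u i * l i)) (\<Sum>i\<in>A. ?v i * l i)"
    if "finite A" for A and l :: "nat \<Rightarrow> nat"
    using that by (induction A rule: finite_induct)
      (simp_all add: monom_power mult_monom one_pCons monom_0)
  from this[of "Poly_Mapping.keys m" "Poly_Mapping.lookup m"]
  show "[:[:Poly_Mapping.lookup p m:]:] *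
      (\<Prod>i\<in>Poly_Mapping.keys m. Polynomial.monom (Polynomial.monom 1 (?u i)) (?v i) ^ Poly_Mapping.lookup m i) =
      Polynomial.monom (Polynomial.monom (Poly_Mapping.lookup p m) (weight ?u m)) (weight ?v m)"
    by (simp add: weight_def smult_monom)
qed

text \<open>On a form of degree \<open>d\<close> the two exponents of every monomial add up to \<open>d\<cdot>a\<^sub>n\<close>, so either
  of them determines the other.\<close>

lemma curve_ideal_form_iff:
  fixes f :: "'k::field mpoly"
  assumes f: "f \<in> forms n d" and a: "\<And>i. i \<in> {1..n} \<Longrightarrow> 0 \<le> a i \<and> a i \<le> a n"
  shows "f \<in> curve_ideal n a \<longleftrightarrow> dehom (\<lambda>i. nat (a i)) f = 0"
    and "f \<in> curve_ideal n a \<longleftrightarrow> dehom (\<lambda>i. nat (a n - a i)) f = 0"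
proof -
  let ?u = "\<lambda>i. nat (a n - a i)" and ?v = "\<lambda>i. nat (a i)"
  let ?N = "d * nat (a n)"
  have P: "f \<in> polys n" using f by (simp add: forms_def)
  have uv: "weight ?u m + weight ?v m = ?N" if m: "m \<in> Poly_Mapping.keys f" for m
  proof -
    have "weight ?u m + weight ?v m
        = (\<Sum>i\<in>Poly_Mapping.keys m. nat (a n) * Poly_Mapping.lookup m i)"
      unfolding weight_def sum.distrib[symmetric]
    proof (rule sum.cong[OF refl])
      fix i assume "i \<in> Poly_Mapping.keys m"
      then have "i \<in> {1..n}" using m P unfolding mem_polys_iff by blast
      from a[OF this] have "nat (a n - a i) + nat (a i) = nat (a n)" by linarith
      then show "?u i * Poly_Mapping.lookup m i + ?v i * Poly_Mapping.lookup m i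
          = nat (a n) * Poly_Mapping.lookup m i"
        by (metis add_mult_distrib)
    qed
    also have "\<dots> = nat (a n) * weight (\<lambda>_. 1) m"
      by (simp add: weight_def sum_distrib_left)
    finally show ?thesis using f m by (simp add: mem_forms_iff mult.commute)
  qed
  have co: "Polynomial.coeff (Polynomial.coeff (curve_map n a f) e) e' =
      (\<Sum>m\<in>Poly_Mapping.keys f. if weight ?v m = e \<and> weight ?u m = e' then Poly_Mapping.lookup f m else 0)"
    for e e'
    unfolding curve_map_eq[OF P] coeff_sum by (intro sum.cong) auto
  have I: "f \<in> curve_ideal n a \<longleftrightarrow> (\<forall>e e'. Polynomial.coeff (Polynomial.coeff (curve_map n a f) e) e' = 0)"
    using P by (auto simp: curve_ideal_def poly_eq_iff)
  have v: "Polynomial.coeff (Polynomial.coeff (curve_map n a f) e) e' =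
      (if e + e' = ?N then Polynomial.coeff (dehom ?v f) e else 0)" for e e'
    unfolding co coeff_dehom by (auto dest!: uv intro!: sum.cong sum.neutral)
  have u: "Polynomial.coeff (Polynomial.coeff (curve_map n a f) e) e' =
      (if e + e' = ?N then Polynomial.coeff (dehom ?u f) e' else 0)" for e e'
    unfolding co coeff_dehom by (auto dest!: uv intro!: sum.cong sum.neutral)
  \<comment> \<open>The two preceding formulas only reach exponents up to \<open>?N\<close>; above
    it no monomial contributes.\<close>
  have le: "Polynomial.coeff (dehom ?v f) e = 0 \<and> Polynomial.coeff (dehom ?u f) e = 0" if "e > ?N" for e
    unfolding coeff_dehom using uv that by (force intro!: sum.neutral)
  show "f \<in> curve_ideal n a \<longleftrightarrow> dehom ?v f = 0"
    unfolding I v poly_eq_iff coeff_0 using le by (metis le_add_diff_inverse not_less)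
  show "f \<in> curve_ideal n a \<longleftrightarrow> dehom ?u f = 0"
    unfolding I u poly_eq_iff coeff_0 using le by (metis le_add_diff_inverse2 not_less)
qed

section \<open>Power series supported on a semigroup\<close>

text \<open>For a submonoid \<open>M\<close> this is the ring k[[M]].\<close>

definition fps_supported :: "nat set \<Rightarrow> 'k::comm_ring_1 fps set" where
  "fps_supported M = {f. \<forall>i. fps_nth f i \<noteq> 0 \<longrightarrow> i \<in> M}"

definition fls_of_poly :: "'k::field poly \<Rightarrow> 'k fls" where
  "fls_of_poly p = fps_to_fls (fps_of_poly p)"

lemma fls_of_poly_simps [simp]:
  "fls_of_poly 0 = 0" "fls_of_poly 1 = 1"
  "fls_of_poly (p + q) = fls_of_poly p + fls_of_poly q"
  "fls_of_poly (p - q) = fls_of_poly p - fls_of_poly q"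
  "fls_of_poly (- p) = - fls_of_poly p"
  "fls_of_poly (p * q) = fls_of_poly p * fls_of_poly q"
  "fls_of_poly p = fls_of_poly q \<longleftrightarrow> p = q"
  "fls_of_poly p = 0 \<longleftrightarrow> p = 0"
  by (simp_all add: fls_of_poly_def fps_of_poly_add fps_of_poly_diff fps_of_poly_uminus
      fps_of_poly_mult fls_times_fps_to_fls fps_of_poly_eq_iff)

lemma fps_of_poly_supported_iff:
  "fps_of_poly p \<in> fps_supported M \<longleftrightarrow> (\<forall>i. Polynomial.coeff p i \<noteq> 0 \<longrightarrow> i \<in> M)"
  by (simp add: fps_supported_def)

locale nat_submonoid =
  fixes M :: "nat set"
  assumes zero_mem: "0 \<in> M" and add_mem: "\<And>i j. i \<in> M \<Longrightarrow> j \<in> M \<Longrightarrow> i + j \<in> M"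
begin

lemma fps_supported_const: "fps_const c \<in> fps_supported M"
  using zero_mem by (simp add: fps_supported_def)

lemma fps_supported_add: "f \<in> fps_supported M \<Longrightarrow> g \<in> fps_supported M \<Longrightarrow> f + g \<in> fps_supported M"
  by (auto simp: fps_supported_def) (metis add.right_neutral)

lemma fps_supported_uminus: "f \<in> fps_supported M \<Longrightarrow> - f \<in> fps_supported M"
  by (auto simp: fps_supported_def)

lemma fps_supported_mult:
  assumes "f \<in> fps_supported M" "g \<in> fps_supported M"
  shows "f * g \<in> fps_supported M"
  unfolding fps_supported_def
proof (intro CollectI allI impI)
  fix m assume "fps_nth (f * g) m \<noteq> 0"
  then obtain i where "i \<le> m" "fps_nth f i * fps_nth g (m - i) \<noteq> 0"
    unfolding fps_mult_nth by (metis (no_types, lifting) atLeastAtMost_iff sum.neutral)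
  then have "i \<in> M" "m - i \<in> M" using assms
    by (auto simp: fps_supported_def) (metis mult_zero_left, metis mult_zero_right)
  with add_mem have "i + (m - i) \<in> M" by blast
  then show "m \<in> M" using \<open>i \<le> m\<close> by simp
qed

text \<open>Strong induction along the recursion for the coefficients of the inverse: a nonzero
  coefficient at m > 0 forces some i >= 1 with both i and m - i in \<open>M\<close>. Hence fractions
  over k[M] whose denominator has a nonzero constant term stay in k[[M]].\<close>

lemma fps_supported_inverse:
  fixes f :: "'k::field fps"
  assumes f: "f \<in> fps_supported M" and f0: "fps_nth f 0 \<noteq> 0"
  shows "inverse f \<in> fps_supported M"
proof -
  have "fps_nth (inverse f) m \<noteq> 0 \<longrightarrow> m \<in> M" for m
  proof (induction m rule: less_induct)
    case (less m)
    show ?case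
    proof (intro impI)
      assume nz: "fps_nth (inverse f) m \<noteq> 0"
      show "m \<in> M"
      proof (cases "m = 0")
        case False
        have "0 = fps_nth (f * inverse f) m" using False f0 by (simp add: inverse_mult_eq_1')
        also have "\<dots> = (\<Sum>i=0..m. fps_nth f i * fps_nth (inverse f) (m - i))" by (simp add: fps_mult_nth)
        also have "\<dots> = fps_nth f 0 * fps_nth (inverse f) m
            + (\<Sum>i=1..m. fps_nth f i * fps_nth (inverse f) (m - i))"
          by (simp add: sum.atLeast_Suc_atMost)
        finally have "(\<Sum>i=1..m. fps_nth f i * fps_nth (inverse f) (m - i)) \<noteq> 0"
          using nz f0 by auto
        then obtain i where i: "1 \<le> i" "i \<le> m" "fps_nth f i * fps_nth (inverse f) (m - i) \<noteq> 0"
          by (metis (no_types, lifting) atLeastAtMost_iff sum.neutral)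
        then have "i \<in> M" using f by (auto simp: fps_supported_def)
        moreover have "m - i \<in> M" using i less.IH[of "m - i"] by auto
        ultimately have "i + (m - i) \<in> M" by (rule add_mem)
        then show ?thesis using i by simp
      qed (use zero_mem in simp)
    qed
  qed
  then show ?thesis by (simp add: fps_supported_def)
qed

end

text \<open>Because y is a power series, a factor t of the denominator also divides the numerator.
  Cancelling it lowers the degree of the denominator, so the process stops at a nonzero constant
  term.\<close>

lemma fps_of_poly_lead_unit:
  fixes g :: "'k::field poly"
  assumes "g \<noteq> 0" "y * fps_of_poly g = fps_of_poly f"
  shows "\<exists>f' g'. y * fps_of_poly g' = fps_of_poly f' \<and> Polynomial.coeff g' 0 \<noteq> 0"
  using assms
proof (induction "Polynomial.degree g" arbitrary: f g rule: less_induct)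
  case less
  show ?case
  proof (cases "Polynomial.coeff g 0 = 0")
    case True
    then obtain g1 where g1: "g = pCons 0 g1" by (cases g) auto
    have "Polynomial.coeff f 0 = fps_nth (y * fps_of_poly g) 0" by (simp add: less.prems)
    also have "\<dots> = 0" using True by simp
    finally obtain f1 where f1: "f = pCons 0 f1" by (cases f) auto
    have "fps_X * (y * fps_of_poly g1) = fps_X * fps_of_poly f1"
      using less.prems(2) by (simp add: f1 g1 fps_of_poly_pCons mult_ac)
    then have "y * fps_of_poly g1 = fps_of_poly f1" by simp
    moreover have "g1 \<noteq> 0" using less.prems(1) g1 by auto
    ultimately show ?thesis
      using less.hyps[of g1 f1] by (auto simp: g1)
  qed (use less.prems in blast)
qed

text \<open>Coefficients of a product below order c depend only on coefficients of the factors below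
  order c, so the inverse power series may be cut off there and becomes a polynomial.\<close>

lemma poly_inverse_mod_monom:
  fixes g :: "'k::field poly"
  assumes "Polynomial.coeff g 0 \<noteq> 0" "c > 0"
  shows "\<exists>h. \<forall>i<c. Polynomial.coeff (g * h) i = (if i = 0 then 1 else 0)"
proof (intro exI allI impI)
  define v where "v = inverse (fps_of_poly g)"
  define h where "h = truncate_fps c v"
  fix i assume i: "i < c"
  have "Polynomial.coeff (g * h) i = fps_nth (fps_of_poly g * fps_cutoff c v) i"
    unfolding h_def by (simp flip: fps_of_poly_truncate fps_of_poly_mult del: fps_of_poly_truncate)
  also have "\<dots> = fps_nth (fps_of_poly g * v) i"
    unfolding fps_mult_nth using i by (intro sum.cong) auto
  also have "\<dots> = (if i = 0 then 1 else 0)"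
    using assms by (simp add: v_def inverse_mult_eq_1')
  finally show "Polynomial.coeff (g * truncate_fps c (inverse (fps_of_poly g))) i = (if i = 0 then 1 else 0)"
    unfolding h_def v_def .
qed

section \<open>Integrality over rings of power series\<close>

text \<open>The convention that the zero series has subdegree 0 makes the criterion cover it
  too.\<close>

lemma fps_to_fls_iff_subdegree:
  "z \<in> range fps_to_fls \<longleftrightarrow> fls_subdegree z \<ge> 0"
  by (metis UNIV_I fls_regpart_to_fls_trivial fls_subdegree_fls_to_fps_gt0 imageE image_eqI)

lemma fps_to_fls_sum: "fps_to_fls (\<Sum>i\<in>A. f i) = (\<Sum>i\<in>A. fps_to_fls (f i))"
  by (induction A rule: infinite_finite_induct) auto

text \<open>For \<open>x\<close> with a pole put \<open>y = 1/x\<close>: dividing \<open>q(x) = 0\<close> by \<open>x\<^sup>d\<close> writes \<open>1\<close> as a power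
  series without constant term.\<close>

lemma fls_integral_imp_power_series:
  fixes x :: "'k::field fls"
  assumes monic: "Polynomial.lead_coeff q = 1" and co: "\<And>i. Polynomial.coeff q i \<in> range fps_to_fls"
    and root: "poly q x = 0"
  shows "x \<in> range fps_to_fls"
proof (rule ccontr)
  assume "x \<notin> range fps_to_fls"
  then have neg: "fls_subdegree x < 0" unfolding fps_to_fls_iff_subdegree by linarith
  then have x0: "x \<noteq> 0" by auto
  define y where "y = inverse x"
  have "fls_subdegree y > 0" using neg unfolding y_def fls_inverse_subdegree by linarith
  moreover from this obtain f where f: "y = fps_to_fls f"
    by (metis fps_to_fls_iff_subdegree imageE order_less_imp_le)
  ultimately have f0: "fps_nth f 0 = 0"
    by (metis fls_eq0_below_subdegree fps_to_fls_nth nat_zero_as_int order_refl not_less)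
  let ?d = "Polynomial.degree q"
  have "\<forall>i. \<exists>h. Polynomial.coeff q i = fps_to_fls h" using co by blast
  then obtain g where g: "\<And>i. Polynomial.coeff q i = fps_to_fls (g i)" by (auto dest: choice)
  have gd: "g ?d = 1" using g[of ?d] monic by (metis fps_to_fls_eq_1_iff)
  have "0 = y ^ ?d * poly q x" using root by simp
  also have "\<dots> = (\<Sum>i\<le>?d. Polynomial.coeff q i * (y ^ ?d * x ^ i))"
    by (simp add: poly_altdef sum_distrib_left mult_ac)
  also have "\<dots> = (\<Sum>i\<le>?d. fps_to_fls (g i * f ^ (?d - i)))"
  proof (intro sum.cong refl)
    fix i assume "i \<in> {..?d}"
    then have "y ^ ?d * x ^ i = y ^ (?d - i) * (y ^ i * x ^ i)"
      by (metis atMost_iff le_add_diff_inverse2 mult.assoc power_add)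
    also have "y ^ i * x ^ i = 1" using x0 by (simp add: y_def power_mult_distrib[symmetric])
    finally show "Polynomial.coeff q i * (y ^ ?d * x ^ i) = fps_to_fls (g i * f ^ (?d - i))"
      by (simp add: g f fps_to_fls_power fls_times_fps_to_fls)
  qed
  also have "\<dots> = fps_to_fls (\<Sum>i\<le>?d. g i * f ^ (?d - i))"
    by (rule fps_to_fls_sum[symmetric])
  finally have "(\<Sum>i\<le>?d. g i * f ^ (?d - i)) = 0" by simp
  \<comment> \<open>The term i = d equals 1, while each other term keeps a positive power of
    \<open>f\<close> and so has no constant term.\<close>
  moreover have "(\<Sum>i\<le>?d. g i * f ^ (?d - i)) = (\<Sum>i<?d. g i * f ^ (?d - i)) + 1"
    by (simp add: gd lessThan_Suc_atMost[symmetric])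
  moreover have "fps_nth (\<Sum>i<?d. g i * f ^ (?d - i)) 0 = 0"
    using f0 by (auto simp: fps_sum_nth fps_power_zeroth zero_power intro!: sum.neutral)
  ultimately have "fps_nth 0 0 = (1::'k)" by (metis add_0 fps_add_nth fps_one_nth)
  then show False by simp
qed

text \<open>Multiplication by X - a only uses ring operations on coefficients. This puts the monic
  equation that witnesses integrality over the subring \<open>S\<close>.\<close>

lemma coeffs_diff_const_power_minus:
  fixes a b :: "'b::comm_ring_1"
  assumes S1: "1 \<in> S" and Sadd: "\<And>x y. x \<in> S \<Longrightarrow> y \<in> S \<Longrightarrow> x + y \<in> S"
    and Smult: "\<And>x y. x \<in> S \<Longrightarrow> y \<in> S \<Longrightarrow> x * y \<in> S" and Sum: "\<And>x. x \<in> S \<Longrightarrow> - x \<in> S"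
    and ab: "a \<in> S" "b \<in> S"
  shows "Polynomial.coeff ([:- a, 1:] ^ m - [:b:]) i \<in> S"
proof -
  have S0: "0 \<in> S" using Sadd[OF S1 Sum[OF S1]] by simp
  have "Polynomial.coeff ([:- a, 1:] ^ m) i \<in> S" for i
  proof (induction m arbitrary: i)
    case 0
    then show ?case using S0 S1 by (cases i) auto
  next
    case (Suc m)
    have "[:- a, 1:] ^ Suc m = smult (- a) ([:- a, 1:] ^ m) + pCons 0 ([:- a, 1:] ^ m)" by simp
    moreover have "Polynomial.coeff (pCons 0 ([:- a, 1:] ^ m)) i \<in> S"
      using Suc S0 by (cases i) simp_all
    moreover have "- a * Polynomial.coeff ([:- a, 1:] ^ m) i \<in> S"
      using Suc ab by (intro Smult Sum)
    ultimately show ?case using Sadd by (simp only: coeff_add coeff_smult)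
  qed
  from this[of i] have "Polynomial.coeff ([:- a, 1:] ^ m) i + - Polynomial.coeff [:b:] i \<in> S"
    using S0 ab by (intro Sadd Sum) (cases i; simp)+
  then show ?thesis by simp
qed

section \<open>The local ring on a monomial chart\<close>

text \<open>On the affine chart \<open>X\<^sub>j = 1\<close> the coordinates are \<open>X\<^sub>i = t^(w i)\<close>, and \<open>M\<close> is the semigroup
  generated by the \<open>w i\<close>.\<close>

locale monomial_chart =
  fixes n j :: nat and w :: "nat \<Rightarrow> nat" and I :: "'k::field mpoly set"
  assumes j: "j \<in> {1..n}" and wj: "w j = 0" and wpos: "\<And>i. i \<in> {1..n} \<Longrightarrow> i \<noteq> j \<Longrightarrow> w i > 0"
    and ideal_iff: "\<And>f d. f \<in> forms n d \<Longrightarrow> f \<in> I \<longleftrightarrow> dehom w f = 0"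
    and finite_gaps: "finite (- {weight w m | m. Poly_Mapping.keys m \<subseteq> {1..n}})"
begin

definition M :: "nat set" where
  "M = {weight w m | m. Poly_Mapping.keys m \<subseteq> {1..n}}"

definition val :: "'k mpoly \<times> 'k mpoly \<Rightarrow> 'k fls" where
  "val p = fls_of_poly (dehom w (fst p)) / fls_of_poly (dehom w (snd p))"

text \<open>This turns out to be all of k(t); see \<open>K_iff\<close>.\<close>

definition K :: "'k fls set" where
  "K = val ` hfracs n I"

text \<open>The fibres of \<open>val\<close> are the equivalence classes of fractions of forms, so
  this map inverts the embedding of the function field into k((t)).\<close>

definition fraction :: "'k fls \<Rightarrow> ('k mpoly \<times> 'k mpoly) set" where
  "fraction z = {p \<in> hfracs n I. val p = z}"

lemma M0: "0 \<in> M"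
  unfolding M_def by (rule CollectI, rule exI[of _ 0]) simp

lemma M_add:
  assumes "x \<in> M" "y \<in> M"
  shows "x + y \<in> M"
proof -
  from assms obtain m m' where m: "x = weight w m" "Poly_Mapping.keys m \<subseteq> {1..n}"
    "y = weight w m'" "Poly_Mapping.keys m' \<subseteq> {1..n}" by (auto simp: M_def)
  then have "Poly_Mapping.keys (m + m') \<subseteq> {1..n}"
    using Poly_Mapping.keys_add[of m m'] by blast
  then show ?thesis using m unfolding M_def by (metis (mono_tags, lifting) mem_Collect_eq weight_add)
qed

sublocale nat_submonoid M
  by unfold_locales (use M0 M_add in auto)

text \<open>Positivity of c is arranged because c serves as a truncation order and as the exponent
  of a monic equation.\<close>

lemma conductor_exists: "\<exists>c>0. \<forall>i\<ge>c. i \<in> M"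
proof -
  have "finite (- M)" using finite_gaps by (simp add: M_def)
  then obtain c where "\<forall>i\<in>- M. i \<le> c" using finite_nat_set_iff_bounded_le by blast
  then show ?thesis by (intro exI[of _ "Suc c"]) force
qed

text \<open>The variable X_j has weight 0, so multiplying by its powers raises the degree and leaves
  the weight alone.\<close>

lemma monomial_of_large_degree:
  assumes "x \<in> M"
  shows "\<exists>d0. \<forall>d\<ge>d0. \<exists>m. Poly_Mapping.keys m \<subseteq> {1..n} \<and> weight (\<lambda>_. 1) m = d \<and> weight w m = x"
proof -
  from assms obtain m where m: "x = weight w m" "Poly_Mapping.keys m \<subseteq> {1..n}"
    by (auto simp: M_def)
  show ?thesis
  proof (intro exI allI impI)
    fix d assume d: "weight (\<lambda>_. 1) m \<le> d"
    let ?m = "m + Poly_Mapping.single j (d - weight (\<lambda>_. 1) m)"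
    have "Poly_Mapping.keys ?m \<subseteq> {1..n}"
      using m(2) j Poly_Mapping.keys_add[of m "Poly_Mapping.single j (d - weight (\<lambda>_. 1) m)"]
      by (fastforce split: if_splits)
    then show "Poly_Mapping.keys ?m \<subseteq> {1..n} \<and> weight (\<lambda>_. 1) ?m = d \<and> weight w ?m = x"
      using d m(1) by (simp add: weight_add wj)
  qed
qed

text \<open>Having every large degree available, and not just one, lets monomials be added in a
  common degree, and later lets numerator and denominator of a fraction share their degree.\<close>

lemma dehom_forms_surj:
  assumes p: "fps_of_poly p \<in> fps_supported M"
  shows "\<exists>d0. \<forall>d\<ge>d0. \<exists>f\<in>forms n d. dehom w f = p"
proof -
  let ?D = "{i. i \<le> Polynomial.degree p \<and> Polynomial.coeff p i \<noteq> 0}"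
  have D: "?D \<subseteq> M" using p by (auto simp: fps_of_poly_supported_iff)
  have sum: "\<exists>d0. \<forall>d\<ge>d0. \<exists>f\<in>forms n d. dehom w f = (\<Sum>i\<in>A. Polynomial.monom (c i) i)"
    if "finite A" "A \<subseteq> M" for A c
    using that
  proof (induction A rule: finite_induct)
    case empty
    then show ?case by (intro exI[of _ 0]) (auto intro!: bexI[of _ 0] forms_zero)
  next
    case (insert x A)
    then obtain d0 where d0: "\<And>d. d \<ge> d0 \<Longrightarrow>
        \<exists>f\<in>forms n d. dehom w f = (\<Sum>i\<in>A. Polynomial.monom (c i) i)" by auto
    from insert.prems obtain d1 where d1: "\<And>d. d \<ge> d1 \<Longrightarrow>
        \<exists>m. Poly_Mapping.keys m \<subseteq> {1..n} \<and> weight (\<lambda>_. 1) m = d \<and> weight w m = x"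
      using monomial_of_large_degree[of x] by blast
    show ?case
    proof (intro exI allI impI)
      fix d assume "max d0 d1 \<le> d"
      then obtain f m where f: "f \<in> forms n d" "dehom w f = (\<Sum>i\<in>A. Polynomial.monom (c i) i)"
        and m: "Poly_Mapping.keys m \<subseteq> {1..n}" "weight (\<lambda>_. 1) m = d" "weight w m = x"
        using d0[of d] d1[of d] by auto
      have "Poly_Mapping.single m (c x) + f \<in> forms n d"
        using forms_single[OF m(1), of "c x"] f(1) m(2) by (intro forms_add) simp_all
      moreover have "dehom w (Poly_Mapping.single m (c x) + f) = (\<Sum>i\<in>insert x A. Polynomial.monom (c i) i)"
        using insert.hyps f m by (simp add: dehom_add)
      ultimately show "\<exists>f\<in>forms n d. dehom w f = (\<Sum>i\<in>insert x A. Polynomial.monom (c i) i)" by blast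
    qed
  qed
  have "(\<Sum>i\<in>?D. Polynomial.monom (Polynomial.coeff p i) i)
      = (\<Sum>i\<le>Polynomial.degree p. Polynomial.monom (Polynomial.coeff p i) i)"
    by (rule sum.mono_neutral_left) auto
  also have "\<dots> = p" by (rule poly_as_sum_of_monoms)
  finally show ?thesis using sum[OF _ D, of "Polynomial.coeff p"] by simp
qed

lemma dehom_supported: "f \<in> polys n \<Longrightarrow> fps_of_poly (dehom w f) \<in> fps_supported M"
  unfolding fps_of_poly_supported_iff coeff_dehom
proof (intro allI impI)
  fix i assume f: "f \<in> polys n"
    and "(\<Sum>m\<in>Poly_Mapping.keys f. if weight w m = i then Poly_Mapping.lookup f m else 0) \<noteq> 0"
  then obtain m where "m \<in> Poly_Mapping.keys f" "weight w m = i"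
    by (elim sum.not_neutral_contains_not_neutral) (auto split: if_splits)
  then show "i \<in> M" using f by (auto simp: M_def mem_polys_iff)
qed

section \<open>The function field as the field of rational functions in t\<close>

lemma hfracs_iff:
  "(f, g) \<in> hfracs n I \<longleftrightarrow> (\<exists>d. f \<in> forms n d \<and> g \<in> forms n d \<and> dehom w g \<noteq> 0)"
  unfolding hfracs_def using ideal_iff by auto

lemma hfracs_polys: "(f, g) \<in> hfracs n I \<Longrightarrow> f \<in> polys n \<and> g \<in> polys n"
  by (auto simp: hfracs_iff forms_def)

lemma val_in_K: "p \<in> hfracs n I \<Longrightarrow> val p \<in> K"
  by (simp add: K_def)

lemma supported_fraction:
  assumes "fps_of_poly p \<in> fps_supported M" "fps_of_poly q \<in> fps_supported M" "q \<noteq> 0"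
  shows "\<exists>f g. (f, g) \<in> hfracs n I \<and> dehom w f = p \<and> dehom w g = q"
proof -
  obtain d0 where d0: "\<And>d. d \<ge> d0 \<Longrightarrow> \<exists>f\<in>forms n d. dehom w f = p"
    using dehom_forms_surj[OF assms(1)] by blast
  obtain d1 where d1: "\<And>d. d \<ge> d1 \<Longrightarrow> \<exists>f\<in>forms n d. dehom w f = q"
    using dehom_forms_surj[OF assms(2)] by blast
  from d0[of "max d0 d1"] d1[of "max d0 d1"] show ?thesis
    using assms(3) unfolding hfracs_iff by auto
qed

text \<open>Multiplication by t^c pushes all exponents past the conductor, where \<open>M\<close>
  has no gaps.\<close>

lemma fraction_of_supported:
  fixes p q :: "'k poly"
  assumes "q \<noteq> 0"
  shows "\<exists>p' q'. fps_of_poly p' \<in> fps_supported M \<and> fps_of_poly q' \<in> fps_supported M \<and> q' \<noteq> 0 \<and>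
    fls_of_poly p / fls_of_poly q = fls_of_poly p' / fls_of_poly q'"
proof -
  obtain c where c: "\<forall>i\<ge>c. i \<in> M" using conductor_exists by blast
  have s: "fps_of_poly (Polynomial.monom 1 c * r) \<in> fps_supported M" for r :: "'k poly"
    using c by (auto simp: fps_of_poly_supported_iff coeff_monom_mult split: if_splits)
  show ?thesis
    by (rule exI[of _ "Polynomial.monom 1 c * p"], rule exI[of _ "Polynomial.monom 1 c * q"])
       (use s assms in simp)
qed

lemma K_iff: "z \<in> K \<longleftrightarrow> (\<exists>p q. q \<noteq> 0 \<and> z = fls_of_poly p / fls_of_poly q)"
proof
  assume "z \<in> K"
  then obtain f g where "(f, g) \<in> hfracs n I" "z = val (f, g)" by (auto simp: K_def)
  then show "\<exists>p q. q \<noteq> 0 \<and> z = fls_of_poly p / fls_of_poly q"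
    by (auto simp: hfracs_iff val_def)
next
  assume "\<exists>p q. q \<noteq> 0 \<and> z = fls_of_poly p / fls_of_poly q"
  then obtain p q where "fps_of_poly p \<in> fps_supported M" "fps_of_poly q \<in> fps_supported M" "q \<noteq> 0"
      "z = fls_of_poly p / fls_of_poly q"
    using fraction_of_supported by metis
  moreover from this obtain f g where "(f, g) \<in> hfracs n I" "dehom w f = p" "dehom w g = q"
    using supported_fraction by blast
  ultimately show "z \<in> K" unfolding K_def by (auto simp: val_def intro!: image_eqI[of _ _ "(f, g)"])
qed

lemma K_fls_of_poly: "fls_of_poly p \<in> K"
  unfolding K_iff by (rule exI[of _ p], rule exI[of _ 1]) simp

lemma K_closed:
  assumes "x \<in> K" "y \<in> K"
  shows "x + y \<in> K" "x * y \<in> K" "- x \<in> K" "inverse x \<in> K"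
proof -
  obtain p q where x: "q \<noteq> 0" "x = fls_of_poly p / fls_of_poly q" using assms(1) K_iff by blast
  obtain p' q' where y: "q' \<noteq> 0" "y = fls_of_poly p' / fls_of_poly q'" using assms(2) K_iff by blast
  show "x + y \<in> K" unfolding K_iff
    by (rule exI[of _ "p * q' + p' * q"], rule exI[of _ "q * q'"]) (use x y in \<open>simp add: add_frac_eq\<close>)
  show "x * y \<in> K" unfolding K_iff
    by (rule exI[of _ "p * p'"], rule exI[of _ "q * q'"]) (use x y in simp)
  show "- x \<in> K" unfolding K_iff
    by (rule exI[of _ "- p"], rule exI[of _ q]) (use x in simp)
  show "inverse x \<in> K"
  proof (cases "p = 0")
    case True
    then show ?thesis using x K_fls_of_poly[of 0] by simp
  next
    case False
    then show ?thesis unfolding K_iff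
      by (intro exI[of _ q] exI[of _ p]) (use x in simp)
  qed
qed

text \<open>Membership in the ideal is controlled only for forms. The cross difference is a form of
  degree d + d', so it lies in the ideal exactly when the dehomogenized products agree, which is
  equality of quotients in k((t)).\<close>

lemma hfrac_eq_fraction:
  assumes "(f, g) \<in> hfracs n I"
  shows "hfrac n I f g = fraction (val (f, g))"
proof -
  obtain d where d: "f \<in> forms n d" "g \<in> forms n d" "dehom w g \<noteq> 0"
    using assms by (auto simp: hfracs_iff)
  have "f * g' - f' * g \<in> I \<longleftrightarrow> val (f', g') = val (f, g)" if fg': "(f', g') \<in> hfracs n I" for f' g'
  proof -
    obtain d' where d': "f' \<in> forms n d'" "g' \<in> forms n d'" "dehom w g' \<noteq> 0"
      using fg' by (auto simp: hfracs_iff)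
    have "f * g' - f' * g \<in> forms n (d + d')"
      using forms_mult[OF d(1) d'(2)] forms_mult[OF d'(1) d(2)]
      by (intro forms_diff) (simp_all add: add.commute)
    then have "f * g' - f' * g \<in> I \<longleftrightarrow> dehom w f * dehom w g' = dehom w f' * dehom w g"
      by (simp add: ideal_iff dehom_diff dehom_mult)
    also have "\<dots> \<longleftrightarrow> fls_of_poly (dehom w f * dehom w g') = fls_of_poly (dehom w f' * dehom w g)"
      by (rule fls_of_poly_simps(7)[symmetric])
    also have "\<dots> \<longleftrightarrow> val (f', g') = val (f, g)"
    proof -
      have "fls_of_poly (dehom w g) \<noteq> 0" "fls_of_poly (dehom w g') \<noteq> 0" using d d' by simp_all
      then have "val (f, g) = val (f', g') \<longleftrightarrow>
          fls_of_poly (dehom w f) * fls_of_poly (dehom w g') = fls_of_poly (dehom w f') * fls_of_poly (dehom w g)"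
        unfolding val_def fst_conv snd_conv by (rule frac_eq_eq)
      then show ?thesis by (metis fls_of_poly_simps(6))
    qed
    finally show ?thesis .
  qed
  then show ?thesis
    using assms by (auto simp: hfrac_def hfrac_rel_def fraction_def)
qed

lemma hfracs_one: "(1, 1) \<in> hfracs n I"
  unfolding hfracs_iff using forms_one by (intro exI[of _ 0]) simp

lemma hfracs_const: "(Poly_Mapping.single 0 c, 1) \<in> hfracs n I"
  unfolding hfracs_iff using forms_one forms_single[of 0 n c] by (intro exI[of _ 0]) simp

lemma hfracs_zero: "(0, 1) \<in> hfracs n I"
  unfolding hfracs_iff by (intro exI[of _ 0]) (simp add: forms_one forms_zero)

lemma hfracs_arith:
  assumes "(f, g) \<in> hfracs n I" "(f', g') \<in> hfracs n I"
  shows "(f * f', g * g') \<in> hfracs n I" "(f * g' + f' * g, g * g') \<in> hfracs n I"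
    "val (f * f', g * g') = val (f, g) * val (f', g')"
    "val (f * g' + f' * g, g * g') = val (f, g) + val (f', g')"
proof -
  obtain d where d: "f \<in> forms n d" "g \<in> forms n d" "dehom w g \<noteq> 0"
    using assms by (auto simp: hfracs_iff)
  obtain d' where d': "f' \<in> forms n d'" "g' \<in> forms n d'" "dehom w g' \<noteq> 0"
    using assms by (auto simp: hfracs_iff)
  have "f' * g \<in> forms n (d + d')" using forms_mult[OF d'(1) d(2)] by (simp add: add.commute)
  then show "(f * f', g * g') \<in> hfracs n I" "(f * g' + f' * g, g * g') \<in> hfracs n I"
    unfolding hfracs_iff using d d'
    by (auto intro!: exI[of _ "d + d'"] forms_mult forms_add simp: dehom_mult)
  show "val (f * f', g * g') = val (f, g) * val (f', g')"
    by (simp add: val_def dehom_mult)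
  show "val (f * g' + f' * g, g * g') = val (f, g) + val (f', g')"
    using d d' by (simp add: val_def dehom_mult dehom_add add_frac_eq)
qed

lemma fraction_nonempty: "z \<in> K \<Longrightarrow> fraction z \<noteq> {}"
  by (auto simp: K_def fraction_def)

lemma field_model_function_field: "field_model (function_field n I) fraction K"
proof
  show "1 \<in> K" using K_fls_of_poly[of 1] by simp
  have "hfrac_rel n I `` {p} = fraction (val p)" if "p \<in> hfracs n I" for p
    using hfrac_eq_fraction[of "fst p" "snd p"] that by (simp add: hfrac_def)
  then show "carrier (function_field n I) = fraction ` K"
    by (auto simp: function_field_def quotient_def K_def)
  show "inj_on fraction K"
  proof (rule inj_onI)
    fix x y assume "x \<in> K" "y \<in> K" "fraction x = fraction y"
    then obtain p where "p \<in> fraction x" "p \<in> fraction y" using fraction_nonempty by blast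
    then show "x = y" by (simp add: fraction_def)
  qed
  fix x y assume xy: "x \<in> K" "y \<in> K"
  \<comment> \<open>The operations of the record are unions over representatives. Independence of
    the representatives makes the members of the union equal, and nonemptiness of the classes is
    what keeps the union from being empty.\<close>
  have UN: "(\<Union>(f, g)\<in>fraction x. \<Union>(f', g')\<in>fraction y. H f g f' g') = Z"
    if "\<And>f g f' g'. (f, g) \<in> fraction x \<Longrightarrow> (f', g') \<in> fraction y \<Longrightarrow> H f g f' g' = Z"
    for H and Z :: "('k mpoly \<times> 'k mpoly) set"
  proof -
    have "(\<Union>(f, g)\<in>fraction x. \<Union>(f', g')\<in>fraction y. H f g f' g')
        = (\<Union>p\<in>fraction x. \<Union>q\<in>fraction y. Z)"
      using that by (intro SUP_cong) auto
    then show ?thesis using fraction_nonempty xy by simp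
  qed
  show "x + y \<in> K" "x * y \<in> K" using K_closed xy by auto
  have "hfrac n I (f * f') (g * g') = fraction (x * y)"
    if "(f, g) \<in> fraction x" "(f', g') \<in> fraction y" for f g f' g'
    using that hfracs_arith[of f g f' g'] by (subst hfrac_eq_fraction) (auto simp: fraction_def)
  then show "fraction x \<otimes>\<^bsub>function_field n I\<^esub> fraction y = fraction (x * y)"
    using UN by (simp add: function_field_def)
  have "hfrac n I (f * g' + f' * g) (g * g') = fraction (x + y)"
    if "(f, g) \<in> fraction x" "(f', g') \<in> fraction y" for f g f' g'
    using that hfracs_arith[of f g f' g'] by (subst hfrac_eq_fraction) (auto simp: fraction_def)
  then show "fraction x \<oplus>\<^bsub>function_field n I\<^esub> fraction y = fraction (x + y)"
    using UN by (simp add: function_field_def)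
next
  fix x assume "x \<in> K"
  then show "- x \<in> K" "inverse x \<in> K" using K_closed by auto
next
  show "\<one>\<^bsub>function_field n I\<^esub> = fraction 1"
    using hfrac_eq_fraction[OF hfracs_one] by (simp add: function_field_def val_def)
  show "\<zero>\<^bsub>function_field n I\<^esub> = fraction 0"
    using hfrac_eq_fraction[OF hfracs_zero] by (simp add: function_field_def val_def)
qed

section \<open>The local ring at the point and its integral closure\<close>

definition S :: "'k fls set" where
  "S = K \<inter> fps_to_fls ` fps_supported M"

lemma fls_of_poly_in_S: "fps_of_poly p \<in> fps_supported M \<Longrightarrow> fls_of_poly p \<in> S"
  using K_fls_of_poly[of p] by (auto simp: S_def fls_of_poly_def)

lemma S_eq: "S = val ` {(f, g) \<in> hfracs n I. Polynomial.coeff (dehom w g) 0 \<noteq> 0}"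
proof (intro equalityI subsetI)
  fix z assume "z \<in> S"
  then obtain y where y: "z = fps_to_fls y" "y \<in> fps_supported M" and "z \<in> K"
    by (auto simp: S_def)
  from \<open>z \<in> K\<close> obtain p q where q: "q \<noteq> 0" "z = fls_of_poly p / fls_of_poly q"
    unfolding K_iff by blast
  have "z * fls_of_poly q = fls_of_poly p" using q by simp
  then have "y * fps_of_poly q = fps_of_poly p"
    by (simp add: y fls_of_poly_def fls_times_fps_to_fls[symmetric])
  with q obtain f g where fg: "y * fps_of_poly g = fps_of_poly f" "Polynomial.coeff g 0 \<noteq> 0"
    using fps_of_poly_lead_unit by blast
  obtain c where c: "c > 0" "\<forall>i\<ge>c. i \<in> M" using conductor_exists by blast
  obtain h where h: "\<And>i. i < c \<Longrightarrow> Polynomial.coeff (g * h) i = (if i = 0 then 1 else 0)"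
    using poly_inverse_mod_monom[OF fg(2) c(1)] by blast
  have gh: "fps_of_poly (g * h) \<in> fps_supported M"
    unfolding fps_of_poly_supported_iff using h c M0 by (metis not_less)
  have fh: "y * fps_of_poly (g * h) = fps_of_poly (f * h)"
    by (simp add: fps_of_poly_mult fg(1)[symmetric] mult.assoc)
  \<comment> \<open>The numerator is not adjusted separately: it equals y times the new denominator,
    and both factors lie in k[[M]].\<close>
  then have "fps_of_poly (f * h) \<in> fps_supported M"
    using fps_supported_mult[OF y(2) gh] by simp
  moreover have gh0: "Polynomial.coeff (g * h) 0 = 1" using h[of 0] c by simp
  moreover from this have "g * h \<noteq> 0" by auto
  ultimately obtain f' g' where f'g': "(f', g') \<in> hfracs n I" "dehom w f' = f * h" "dehom w g' = g * h"
    using supported_fraction[OF _ gh] by blast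
  have "z * fls_of_poly (g * h) = fls_of_poly (f * h)"
    using fh unfolding fls_of_poly_def y(1) by (simp add: fls_times_fps_to_fls[symmetric])
  then have "z = val (f', g')"
    unfolding val_def fst_conv snd_conv f'g' using \<open>g * h \<noteq> 0\<close>
    by (metis fls_of_poly_simps(8) nonzero_eq_divide_eq)
  then show "z \<in> val ` {(f, g) \<in> hfracs n I. Polynomial.coeff (dehom w g) 0 \<noteq> 0}"
    using f'g' gh0 by (intro image_eqI[of _ _ "(f', g')"]) auto
next
  fix z assume "z \<in> val ` {(f, g) \<in> hfracs n I. Polynomial.coeff (dehom w g) 0 \<noteq> 0}"
  then obtain f g where fg: "(f, g) \<in> hfracs n I" "Polynomial.coeff (dehom w g) 0 \<noteq> 0" "z = val (f, g)"
    by auto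
  let ?f = "fps_of_poly (dehom w f)" and ?g = "fps_of_poly (dehom w g)"
  have "?f \<in> fps_supported M" "inverse ?g \<in> fps_supported M"
    using fg hfracs_polys[OF fg(1)] by (auto intro!: dehom_supported fps_supported_inverse)
  then have "?f * inverse ?g \<in> fps_supported M"
    by (rule fps_supported_mult)
  moreover have "z = fps_to_fls (?f * inverse ?g)"
    using fg(2) by (simp add: fg(3) val_def fls_of_poly_def fls_times_fps_to_fls divide_inverse
        fls_inverse_fps_to_fls subdegree_eq_0)
  moreover have "z \<in> K" using fg val_in_K by blast
  ultimately show "z \<in> S" by (simp add: S_def)
qed

lemma local_ring_eq: "local_ring n I (coord_point j) = fraction ` S"
proof -
  have "local_ring n I (coord_point j)
      = (\<lambda>(f, g). hfrac n I f g) ` {(f, g) \<in> hfracs n I. Polynomial.coeff (dehom w g) 0 \<noteq> 0}"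
    using mpoly_subst_coord_point[where w = w and j = j and n = n, OF _ wj wpos] hfracs_polys
    by (fastforce simp: local_ring_def image_iff)
  also have "\<dots> = (\<lambda>p. fraction (val p)) ` {(f, g) \<in> hfracs n I. Polynomial.coeff (dehom w g) 0 \<noteq> 0}"
    by (rule image_cong) (auto simp: hfrac_eq_fraction)
  finally show ?thesis by (simp add: S_eq image_image)
qed

interpretation L: field_model "function_field n I" fraction K
  by (rule field_model_function_field)

lemma S_closed:
  assumes "x \<in> S" "y \<in> S"
  shows "x + y \<in> S" "x * y \<in> S" "- x \<in> S"
proof -
  from assms obtain f g where fg: "x = fps_to_fls f" "y = fps_to_fls g"
    "f \<in> fps_supported M" "g \<in> fps_supported M" "x \<in> K" "y \<in> K" by (auto simp: S_def)
  have e: "x + y = fps_to_fls (f + g)" "x * y = fps_to_fls (f * g)" "- x = fps_to_fls (- f)"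
    using fg by (simp_all add: fls_times_fps_to_fls)
  then show "x + y \<in> S" "x * y \<in> S" "- x \<in> S"
    unfolding S_def Int_iff using K_closed[OF fg(5,6)] e
      fps_supported_add[OF fg(3,4)] fps_supported_mult[OF fg(3,4)]
      fps_supported_uminus[OF fg(3)] by (metis image_eqI)+
qed

lemma fls_const_in_S: "fls_const c \<in> S"
  using fls_of_poly_in_S[of "[:c:]"] fps_supported_const[of c]
  by (simp add: fls_of_poly_def fps_of_poly_const)

lemma S_subset: "S \<subseteq> K" "S \<subseteq> range fps_to_fls"
  by (auto simp: S_def)

text \<open>A power series with constant term \<open>a\<close> is a root of \<open>(X - a)\<^sup>c - y\<close>, where \<open>y\<close> has order at
  least the conductor \<open>c\<close> and therefore lies in \<open>k[[M]]\<close>.\<close>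

lemma integral_over_S_iff:
  assumes x: "x \<in> K"
  shows "integral_over (function_field n I) (fraction ` S) (fraction x) \<longleftrightarrow> x \<in> range fps_to_fls"
proof -
  have "(\<exists>q. Polynomial.lead_coeff q = 1 \<and> (\<forall>i. Polynomial.coeff q i \<in> S) \<and> poly q x = 0)
      \<longleftrightarrow> x \<in> range fps_to_fls" (is "?ex \<longleftrightarrow> _")
  proof
    assume ?ex
    then show "x \<in> range fps_to_fls" using fls_integral_imp_power_series S_subset(2) by blast
  next
    assume "x \<in> range fps_to_fls"
    then obtain f where f: "x = fps_to_fls f" by auto
    obtain c where c: "c > 0" "\<forall>i\<ge>c. i \<in> M" using conductor_exists by blast
    let ?a = "fls_const (fps_nth f 0)" and ?g = "(f - fps_const (fps_nth f 0)) ^ c"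
    have g: "(x - ?a) ^ c = fps_to_fls ?g" by (simp add: f fps_to_fls_power)
    have "fps_nth ?g i = 0" if "i < c" for i
    \<comment> \<open>A constant series is treated apart, since the zero series has subdegree 0 and
      the order estimate would fail for it.\<close>
    proof (cases "f = fps_const (fps_nth f 0)")
      case True
      then have "f - fps_const (fps_nth f 0) = 0" by (metis right_minus_eq)
      then show ?thesis using c(1) by (simp add: zero_power)
    next
      case False
      then have "1 \<le> subdegree (f - fps_const (fps_nth f 0))"
        by (intro subdegree_geI) simp_all
      then have "i < c * subdegree (f - fps_const (fps_nth f 0))"
        using that by (metis less_le_trans mult_le_mono2 nat_mult_1_right)
      then show ?thesis by (rule fps_pow_nth_below_subdegree)
    qed
    then have "?g \<in> fps_supported M" using c unfolding fps_supported_def by (auto intro: leI)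
    moreover have "(x - ?a) ^ c \<in> K"
      using x S_subset(1) fls_const_in_S[of "fps_nth f 0"] K_closed[of x] K_closed[of ?a]
      by (intro L.K_power) (metis diff_conv_add_uminus in_mono)
    ultimately have gS: "(x - ?a) ^ c \<in> S" using g by (auto simp: S_def)
    let ?q = "[:- ?a, 1:] ^ c - [:(x - ?a) ^ c:]"
    have deg: "Polynomial.degree ([:- ?a, 1:] ^ c) = c" by (simp add: degree_linear_power)
    \<comment> \<open>As c > 0, the subtracted constant does not reach the leading term.\<close>
    then have "Polynomial.degree ?q = c"
      using c(1) Polynomial.degree_add_eq_left[of "- [:(x - ?a) ^ c:]" "[:- ?a, 1:] ^ c"]
      by (simp add: diff_conv_add_uminus del: add_uminus_conv_diff)
    moreover have "Polynomial.coeff ?q c = 1"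
      using c(1) deg lead_coeff_power[of "[:- ?a, 1:]" c] by (cases c) simp_all
    ultimately have "Polynomial.lead_coeff ?q = 1" by simp
    moreover have "Polynomial.coeff ?q i \<in> S" for i
      by (rule coeffs_diff_const_power_minus)
         (use S_closed fls_const_in_S[of 1] fls_const_in_S gS in auto)
    moreover have "poly ?q x = 0" by (simp add: poly_power)
    ultimately show ?ex by blast
  qed
  moreover have "0 \<in> S" using fls_const_in_S[of 0] by simp
  ultimately show ?thesis using L.integral_over_F_iff[OF S_subset(1) _ x] by simp
qed

text \<open>Every element of \<open>K\<close> is a quotient of two polynomials in k[M], so
  \<open>S\<close> has field of fractions \<open>K\<close>, and only the integrality criterion
  remains.\<close>

lemma integral_closure_eq:
  "integral_closure (function_field n I) (fraction ` S) = fraction ` (K \<inter> range fps_to_fls)"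
proof -
  have "\<exists>y\<in>S. \<exists>z\<in>S. z \<noteq> 0 \<and> x = y / z" if "x \<in> K" for x
  proof -
    from that have "\<exists>p q. q \<noteq> 0 \<and> x = fls_of_poly p / fls_of_poly q" by (rule K_iff[THEN iffD1])
    then obtain p' q' where "q' \<noteq> 0" "x = fls_of_poly p' / fls_of_poly q'" by (elim exE conjE)
    then obtain p q where "fps_of_poly p \<in> fps_supported M" "fps_of_poly q \<in> fps_supported M" "q \<noteq> 0"
      "x = fls_of_poly p / fls_of_poly q"
      using fraction_of_supported[of q' p'] by metis
    then show ?thesis
      using fls_of_poly_in_S fls_of_poly_simps(8) by blast
  qed
  then have "generate_field (function_field n I) (fraction ` S) = fraction ` K"
    using L.generate_field_eq_carrier[OF S_subset(1)] by (simp add: L.carrier_eq)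
  then show ?thesis by (auto simp: integral_closure_def integral_over_S_iff)
qed

lemma delta_invariant_eq: "delta_invariant n I (coord_point j) = enat (card (- M))"
proof -
  define W where "W = K \<inter> range (fps_to_fls :: 'k fps \<Rightarrow> 'k fls)"
  \<comment> \<open>Blanking the positions in \<open>M\<close> makes the kernel on power series
    equal to k[[M]] and leaves only the finitely many gap coordinates.\<close>
  define \<tau> where "\<tau> z i = (if i \<in> M then 0 else fls_nth z (int i))" for z :: "'k fls" and i
  have S: "S = {x \<in> W. \<tau> x = (\<lambda>_. 0)}"
  proof -
    have "\<tau> (fps_to_fls f) = (\<lambda>_. 0) \<longleftrightarrow> f \<in> fps_supported M" for f
      by (auto simp: \<tau>_def fps_supported_def fun_eq_iff)
    then show ?thesis by (auto simp: S_def W_def)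
  qed
  have const: "const_frac n I c = fraction (fls_const c)" for c
    using hfrac_eq_fraction[OF hfracs_const, of c]
    by (simp add: const_frac_def val_def monom_0 fls_of_poly_def fps_of_poly_const)
  have "vs_dim (quotient_space (const_frac n I) (function_field n I) (fraction ` W)
      (fraction ` {x \<in> W. \<tau> x = (\<lambda>_. 0)})) = enat (card (- M))"
  proof (rule L.vs_dim_quotient_space[where \<kappa> = fls_const])
    show "finite (- M)" using finite_gaps by (simp add: M_def)
    show "W \<subseteq> K" by (auto simp: W_def)
    show "fls_const c \<in> K" for c using fls_const_in_S S_subset by blast
    show "const_frac n I c = fraction (fls_const c)" for c by (rule const)
    have WE: "\<exists>f. x = fps_to_fls f \<and> x \<in> K" if "x \<in> W" for x using that by (auto simp: W_def)
    fix c x y assume x: "x \<in> W"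
    obtain f where f: "x = fps_to_fls f" "x \<in> K" using WE[OF x] by blast
    have "fls_const c * x = fps_to_fls (fps_const c * f)"
      by (simp add: f fls_times_fps_to_fls)
    moreover have "fls_const c * x \<in> K" using fls_const_in_S S_subset f by (intro K_closed) auto
    ultimately show "fls_const c * x \<in> W" by (simp add: W_def)
    have "- x = fps_to_fls (- f)" using f by simp
    then show "- x \<in> W" unfolding W_def using K_closed(3)[OF f(2) f(2)] by (metis IntI rangeI)
    show "\<tau> (fls_const c * x) = (\<lambda>i. c * \<tau> x i)" by (auto simp: \<tau>_def fun_eq_iff)
    show "\<tau> (x + y) = (\<lambda>i. \<tau> x i + \<tau> y i)" by (auto simp: \<tau>_def fun_eq_iff)
    assume "y \<in> W"
    then obtain g where g: "y = fps_to_fls g" "y \<in> K" using WE by blast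
    have "x + y = fps_to_fls (f + g)" using f g by simp
    then show "x + y \<in> W" unfolding W_def using K_closed(1)[OF f(2) g(2)] by (metis IntI rangeI)
  next
    show "0 \<in> W" using S fls_const_in_S[of 0] by simp
    show "\<tau> ` W = {f. \<forall>i. i \<notin> - M \<longrightarrow> f i = 0}"
    proof (intro equalityI subsetI)
      fix h :: "nat \<Rightarrow> 'k" assume h: "h \<in> {f. \<forall>i. i \<notin> - M \<longrightarrow> f i = 0}"
      \<comment> \<open>Since there are finitely many gaps, prescribed gap coefficients are realized
        by a polynomial, which lies in \<open>K\<close> as well as in k[[t]].\<close>
      define p where "p = (\<Sum>i\<in>- M. Polynomial.monom (h i) i)"
      have "finite (- M)" using finite_gaps by (simp add: M_def)
      then have "Polynomial.coeff p i = h i" for i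
        using h by (auto simp: p_def coeff_sum sum.delta)
      then have "\<tau> (fls_of_poly p) = h" using h by (auto simp: \<tau>_def fun_eq_iff fls_of_poly_def)
      moreover have "fls_of_poly p \<in> W" using K_fls_of_poly by (simp add: W_def fls_of_poly_def)
      ultimately show "h \<in> \<tau> ` W" by blast
    qed (auto simp: \<tau>_def)
  qed
  then show ?thesis
    by (simp add: delta_invariant_def local_ring_eq integral_closure_eq S[symmetric] W_def[symmetric])
qed

end

section \<open>Stable sumsets\<close>

lemma semigroup_gen_mono: "A \<subseteq> B \<Longrightarrow> semigroup_gen A \<subseteq> semigroup_gen B"
proof
  fix x assume AB: "A \<subseteq> B" and "x \<in> semigroup_gen A"
  from this(2) show "x \<in> semigroup_gen B"
    by induction (use AB in \<open>auto intro: semigroup_gen.intros\<close>)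
qed

text \<open>Reflecting \<open>A\<close> produces the element a_n - a_n = 0, which is missing from
  the listed generators of \<Gamma>2.\<close>

lemma semigroup_gen_insert_zero: "semigroup_gen (insert 0 B) = semigroup_gen B"
proof
  show "semigroup_gen (insert 0 B) \<subseteq> semigroup_gen B"
  proof
    fix x assume "x \<in> semigroup_gen (insert 0 B)"
    then show "x \<in> semigroup_gen B"
      by induction (auto intro: semigroup_gen.intros)
  qed
qed (intro semigroup_gen_mono subset_insertI)

lemma semigroup_gen_mult: "b \<in> B \<Longrightarrow> b * int k \<in> semigroup_gen B"
  by (induction k) (auto simp: algebra_simps intro: semigroup_gen.intros)

lemma semigroup_gen_sum:
  "(\<And>i. i \<in> A \<Longrightarrow> f i \<in> semigroup_gen B) \<Longrightarrow> (\<Sum>i\<in>A. f i) \<in> semigroup_gen B"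
  by (induction A rule: infinite_finite_induct) (auto intro: semigroup_gen.intros)

text \<open>An element of the semigroup is a sum of generators with multiplicities, and the
  multiplicities form the exponents of a monomial. This links the integer semigroups with the
  exponent set of a chart.\<close>

lemma semigroup_gen_eq_weights:
  "semigroup_gen ((\<lambda>i. int (w i)) ` {1..n}) = int ` {weight w m | m. Poly_Mapping.keys m \<subseteq> {1..n}}"
    (is "?G = int ` ?M")
proof (intro equalityI subsetI)
  fix x assume "x \<in> ?G"
  then show "x \<in> int ` ?M"
  proof induction
    case zero
    show ?case by (intro image_eqI[of _ _ 0] CollectI exI[of _ 0]) simp_all
  next
    case (gen b)
    then obtain i where "i \<in> {1..n}" "b = int (w i)" by auto
    then show ?case
      by (intro image_eqI[of _ _ "w i"] CollectI exI[of _ "Poly_Mapping.single i 1"]) simp_all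
  next
    case (add x y)
    then obtain m m' where m: "x = int (weight w m)" "Poly_Mapping.keys m \<subseteq> {1..n}"
      "y = int (weight w m')" "Poly_Mapping.keys m' \<subseteq> {1..n}" by auto
    then have "Poly_Mapping.keys (m + m') \<subseteq> {1..n}"
      using Poly_Mapping.keys_add[of m m'] by blast
    then show ?case using m
      by (intro image_eqI[of _ _ "weight w (m + m')"] CollectI exI[of _ "m + m'"])
         (simp_all add: weight_add)
  qed
next
  fix x assume "x \<in> int ` ?M"
  then obtain m where m: "x = int (weight w m)" "Poly_Mapping.keys m \<subseteq> {1..n}" by auto
  have "x = (\<Sum>i\<in>Poly_Mapping.keys m. int (w i) * int (Poly_Mapping.lookup m i))"
    by (simp add: m(1) weight_def)
  also have "\<dots> \<in> ?G"
    using m(2) by (intro semigroup_gen_sum semigroup_gen_mult) auto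
  finally show "x \<in> ?G" .
qed

text \<open>Sorting preserves the sum; without the order condition lists can be padded
  freely.\<close>

lemma sumset_iter_unsorted:
  "sumset_iter s n b = {sum_list (map b xs) | xs. length xs = s \<and> set xs \<subseteq> {1..n}}"
proof (intro equalityI subsetI)
  fix x assume "x \<in> {sum_list (map b xs) | xs. length xs = s \<and> set xs \<subseteq> {1..n}}"
  then obtain xs where xs: "x = sum_list (map b xs)" "length xs = s" "set xs \<subseteq> {1..n}" by auto
  have "sum_list (map b (sort xs)) = sum_mset (mset (map b (sort xs)))"
    by (rule sum_mset_sum_list[symmetric])
  also have "mset (map b (sort xs)) = mset (map b xs)" by simp
  also have "sum_mset \<dots> = x" by (simp only: xs(1) sum_mset_sum_list)
  finally show "x \<in> sumset_iter s n b"
    using xs unfolding sumset_iter_def by (intro CollectI exI[of _ "sort xs"]) auto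
qed (auto simp: sumset_iter_def)

lemma sumset_iter_reflect:
  "sumset_iter s n (\<lambda>i. N - a i) = (\<lambda>x. int s * N - x) ` sumset_iter s n a"
proof -
  have "sum_list (map (\<lambda>i. N - a i) xs) = int (length xs) * N - sum_list (map a xs)" for xs
    by (induction xs) (auto simp: algebra_simps)
  then show ?thesis unfolding sumset_iter_unsorted by (auto simp: image_iff)
qed

text \<open>Since b_j = 0, a sum of generators can be padded with copies of index j to any greater
  length.\<close>

lemma mem_semigroup_gen_iff_sumset:
  assumes j: "j \<in> {1..n}" "b j = 0"
  shows "m \<in> semigroup_gen (b ` {1..n}) \<longleftrightarrow> (\<exists>s0. \<forall>s\<ge>s0. m \<in> sumset_iter s n b)"
proof
  assume "m \<in> semigroup_gen (b ` {1..n})"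
  then have "\<exists>xs. m = sum_list (map b xs) \<and> set xs \<subseteq> {1..n}"
  proof induction
    case zero
    show ?case by (rule exI[of _ "[]"]) simp
  next
    case (gen x)
    then obtain i where "i \<in> {1..n}" "x = b i" by auto
    then show ?case by (intro exI[of _ "[i]"]) simp
  next
    case (add x y)
    then obtain xs ys where "x = sum_list (map b xs)" "set xs \<subseteq> {1..n}"
      "y = sum_list (map b ys)" "set ys \<subseteq> {1..n}" by auto
    then show ?case by (intro exI[of _ "xs @ ys"]) simp
  qed
  then obtain xs where xs: "m = sum_list (map b xs)" "set xs \<subseteq> {1..n}" by blast
  show "\<exists>s0. \<forall>s\<ge>s0. m \<in> sumset_iter s n b"
  proof (intro exI allI impI)
    fix s assume "length xs \<le> s"
    then show "m \<in> sumset_iter s n b" unfolding sumset_iter_unsorted using xs j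
      by (intro CollectI exI[of _ "xs @ replicate (s - length xs) j"])
         (auto simp: sum_list_replicate)
  qed
next
  assume "\<exists>s0. \<forall>s\<ge>s0. m \<in> sumset_iter s n b"
  then obtain xs where "m = sum_list (map b xs)" "set xs \<subseteq> {1..n}"
    unfolding sumset_iter_unsorted by auto
  then have "m = sum_list (map b xs) \<and> set (map b xs) \<subseteq> b ` {1..n}" by auto
  moreover have "set zs \<subseteq> b ` {1..n} \<Longrightarrow> sum_list zs \<in> semigroup_gen (b ` {1..n})" for zs
    by (induction zs) (auto intro: semigroup_gen.intros)
  ultimately show "m \<in> semigroup_gen (b ` {1..n})" by blast
qed

text \<open>For fixed m, the right end of the interval and the reflected copy of \<open>C2\<close>
  both move beyond m as s grows.\<close>

lemma stable_part_of_sumsets: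
  fixes N :: int and c1 c2 \<sigma> :: nat
  assumes N: "N > 0" and C1: "C1 \<subseteq> {0..int c1 - 2}" and C2: "C2 \<subseteq> {0..int c2 - 2}"
    and T: "\<And>s. s \<ge> \<sigma> \<Longrightarrow> T s = C1 \<union> {int c1..int s * N - int c2} \<union> (\<lambda>x. int s * N - x) ` C2"
  shows "{m. \<exists>s0. \<forall>s\<ge>s0. m \<in> T s} = C1 \<union> {int c1..}"
proof (intro equalityI subsetI)
  fix m assume "m \<in> {m. \<exists>s0. \<forall>s\<ge>s0. m \<in> T s}"
  then obtain s0 where s0: "\<And>s. s \<ge> s0 \<Longrightarrow> m \<in> T s" by blast
  \<comment> \<open>As \<open>N\<close> is at least 1, this choice gives s * N - c2 >= m. The
    reflected part lies at or above s * N - (c2 - 2), so it misses m.\<close>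
  define s where "s = max (max s0 \<sigma>) (nat (\<bar>m\<bar> + int c2))"
  have "int s \<le> int s * N" using N by (simp add: mult_le_cancel_left1)
  moreover have "m + int c2 \<le> int s" by (simp add: s_def)
  ultimately have big: "m \<le> int s * N - int c2" by linarith
  have "m \<in> T s" "s \<ge> \<sigma>" using s0[of s] by (simp_all add: s_def)
  then show "m \<in> C1 \<union> {int c1..}" using T[of s] big C2 by fastforce
next
  fix m assume m: "m \<in> C1 \<union> {int c1..}"
  show "m \<in> {m. \<exists>s0. \<forall>s\<ge>s0. m \<in> T s}"
  proof (intro CollectI exI allI impI)
    fix s assume s: "max \<sigma> (nat (\<bar>m\<bar> + int c2)) \<le> s"
    have "int s \<le> int s * N" using N by (simp add: mult_le_cancel_left1)
    moreover have "m + int c2 \<le> int s" using s by linarith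
    ultimately have "m \<le> int s * N - int c2" by linarith
    then show "m \<in> T s" using T[of s] m s by auto
  qed
qed

lemma is_conductor_of_tail:
  assumes C: "C \<subseteq> {0..int c - 2}" and \<Gamma>: "\<Gamma> = C \<union> {int c..}"
  shows "is_conductor c \<Gamma>" "C = \<Gamma> \<inter> {0..int c - 2}"
proof -
  have "c \<le> c'" if c': "\<forall>m\<ge>int c'. m \<in> \<Gamma>" for c'
  proof (rule ccontr)
    assume "\<not> c \<le> c'"
    \<comment> \<open>The bound c - 2 on \<open>C\<close> leaves c - 1 as a gap, which is what makes
      c minimal.\<close>
    then have "int c - 1 \<in> \<Gamma>" using c' by auto
    then show False using C \<Gamma> by auto
  qed
  then show "is_conductor c \<Gamma>" by (auto simp: is_conductor_def \<Gamma>)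
  show "C = \<Gamma> \<inter> {0..int c - 2}" using C by (auto simp: \<Gamma>)
qed

text \<open>The gaps are the integers of [0, c) outside \<open>C\<close>. As \<open>C\<close> lies
  in that interval, the subtraction of natural numbers does not truncate.\<close>

lemma gaps_of_tail:
  fixes M :: "nat set"
  assumes C: "C \<subseteq> {0..int c - 2}" and M: "int ` M = C \<union> {int c..}"
  shows "finite (- M)" "card (- M) = c - card C"
proof -
  have "int ` (- M) = {0..<int c} - C"
  proof (intro equalityI subsetI)
    fix x assume "x \<in> int ` (- M)"
    then obtain i where i: "x = int i" "int i \<notin> int ` M" by (auto simp: inj_image_mem_iff)
    then show "x \<in> {0..<int c} - C" unfolding M by auto
  next
    fix x assume x: "x \<in> {0..<int c} - C"
    then have "int (nat x) \<notin> int ` M" unfolding M by auto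
    then have "nat x \<in> - M" by blast
    then show "x \<in> int ` (- M)" using x by (intro image_eqI[of _ _ "nat x"]) auto
  qed
  moreover have "inj_on int (- M)" by simp
  moreover have "C \<subseteq> {0..<int c}" using C by auto
  ultimately show "finite (- M)" "card (- M) = c - card C"
    by (metis finite_Diff finite_atLeastLessThan_int finite_imageD,
        metis card_Diff_subset card_atLeastLessThan_int card_image diff_zero
          finite_atLeastLessThan_int finite_subset nat_int)
qed

section \<open>The two points of the curve\<close>

text \<open>One statement serves both points: b = a with j = 1, and b = a_n - a with j = n.
  \<open>D\<close> is the part of the sumset near 0 in the chosen coordinates, \<open>D'\<close> the
  reflected one.\<close>

lemma chart_invariants:
  fixes I :: "'k::field mpoly set" and b :: "nat \<Rightarrow> int" and c c' \<sigma> :: nat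
  assumes j: "j \<in> {1..n}" "b j = 0" and pos: "\<And>i. i \<in> {1..n} \<Longrightarrow> i \<noteq> j \<Longrightarrow> b i > 0"
    and ideal: "\<And>f d. f \<in> forms n d \<Longrightarrow> f \<in> I \<longleftrightarrow> dehom (\<lambda>i. nat (b i)) f = 0"
    and N: "N > 0" and C: "D \<subseteq> {0..int c - 2}" "D' \<subseteq> {0..int c' - 2}"
    and T: "\<And>s. s \<ge> \<sigma> \<Longrightarrow>
      sumset_iter s n b = D \<union> {int c..int s * N - int c'} \<union> (\<lambda>x. int s * N - x) ` D'"
    and \<Gamma>: "\<Gamma> = semigroup_gen (b ` {1..n})"
  shows "delta_invariant n I (coord_point j) = enat (c - card D) \<and>
    is_conductor c \<Gamma> \<and> D = \<Gamma> \<inter> {0..int c - 2}"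
proof -
  let ?w = "\<lambda>i. nat (b i)" and ?M = "{weight (\<lambda>i. nat (b i)) m | m. Poly_Mapping.keys m \<subseteq> {1..n}}"
  have tail: "\<Gamma> = D \<union> {int c..}"
    using stable_part_of_sumsets[OF N C T] mem_semigroup_gen_iff_sumset[where b = b, OF j]
    by (simp add: \<Gamma> set_eq_iff)
  have "b ` {1..n} = (\<lambda>i. int (?w i)) ` {1..n}"
    using j pos by (intro image_cong refl) (metis less_le nat_eq_iff order_refl)
  then have "int ` ?M = D \<union> {int c..}"
    using semigroup_gen_eq_weights[of ?w n] tail by (simp add: \<Gamma>)
  \<comment> \<open>Here the sumset formula yields the finiteness of the gap set on which the chart
    depends.\<close>
  note gaps = gaps_of_tail[OF C(1) this]
  interpret monomial_chart n j ?w I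
    by unfold_locales (use j pos ideal gaps(1) in auto)
  show ?thesis
    using delta_invariant_eq gaps(2) is_conductor_of_tail[OF C(1) tail] by (simp add: M_def)
qed

theorem proposition3p4:
  fixes n \<sigma> c1 c2 :: nat and a :: "nat \<Rightarrow> int" and C1 C2 :: "int set"
    and C :: "'k::field mpoly set" and \<Gamma>1 \<Gamma>2 :: "int set"
  assumes "infinite (UNIV :: 'k set)"
    and "n \<ge> 2"
    and "a 1 = 0" and "strict_mono_on {1..n} a" and "Gcd (a ` {2..n}) = 1"
    and "\<sigma> > 0"
    and "finite C1" and "C1 \<subseteq> {0..int c1 - 2}"
    and "finite C2" and "C2 \<subseteq> {0..int c2 - 2}"
    and "\<And>s. s \<ge> \<sigma> \<Longrightarrow>
           sumset_iter s n a = C1 \<union> {int c1..int s * a n - int c2} \<union> (\<lambda>x. int s * a n - x) ` C2 \<and>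
           C1 \<inter> {int c1..int s * a n - int c2} = {} \<and>
           C1 \<inter> (\<lambda>x. int s * a n - x) ` C2 = {} \<and>
           {int c1..int s * a n - int c2} \<inter> (\<lambda>x. int s * a n - x) ` C2 = {}"
    and "C = curve_ideal n a"
    and "\<Gamma>1 = semigroup_gen (a ` {1..n})"
    and "\<Gamma>2 = semigroup_gen ((\<lambda>i. a n - a i) ` {2..n - 1} \<union> {a n})"
  shows "delta_invariant n C (coord_point 1) = enat (c1 - card C1) \<and>
         is_conductor c1 \<Gamma>1 \<and> C1 = \<Gamma>1 \<inter> {0..int c1 - 2} \<and>
         delta_invariant n C (coord_point n) = enat (c2 - card C2) \<and>
         is_conductor c2 \<Gamma>2 \<and> C2 = \<Gamma>2 \<inter> {0..int c2 - 2}"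
proof -
  have sm: "a i < a k" if "i \<in> {1..n}" "k \<in> {1..n}" "i < k" for i k
    using assms(4) that by (auto simp: strict_mono_on_def)
  have pos: "a i > 0" if "i \<in> {1..n}" "i \<noteq> 1" for i
    using sm[of 1 i] that assms(3) by auto
  have lt: "a i < a n" if "i \<in> {1..n}" "i \<noteq> n" for i
    using sm[of i n] that by auto
  have an: "a n > 0" using pos[of n] assms(2) by auto
  have range: "0 \<le> a i \<and> a i \<le> a n" if "i \<in> {1..n}" for i
    using pos[OF that] lt[OF that] assms(3) an by (cases "i = 1"; cases "i = n") auto
  have T1: "sumset_iter s n a = C1 \<union> {int c1..int s * a n - int c2} \<union> (\<lambda>x. int s * a n - x) ` C2"
    if "s \<ge> \<sigma>" for s using assms(11)[OF that] by blast
  \<comment> \<open>Reflection sends [c1, s a_n - c2] to [c2, s a_n - c1] and exchanges the two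
    exceptional sets.\<close>
  have T2: "sumset_iter s n (\<lambda>i. a n - a i)
      = C2 \<union> {int c2..int s * a n - int c1} \<union> (\<lambda>x. int s * a n - x) ` C1"
    if "s \<ge> \<sigma>" for s
    unfolding sumset_iter_reflect T1[OF that] by (auto simp: image_Un image_image)
  have "(\<lambda>i. a n - a i) ` {1..n} = insert 0 ((\<lambda>i. a n - a i) ` {2..n - 1} \<union> {a n})"
  proof -
    \<comment> \<open>Index n contributes 0, index 1 contributes a_n, and the others give the middle
      generators.\<close>
    have "{1..n} = insert n (insert 1 {2..n - 1})" using assms(2) by auto
    then show ?thesis using assms(3) by auto
  qed
  then have \<Gamma>2: "\<Gamma>2 = semigroup_gen ((\<lambda>i. a n - a i) ` {1..n})"
    using assms(14) semigroup_gen_insert_zero by metis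
  have "delta_invariant n C (coord_point 1) = enat (c1 - card C1) \<and>
      is_conductor c1 \<Gamma>1 \<and> C1 = \<Gamma>1 \<inter> {0..int c1 - 2}"
    by (rule chart_invariants[OF _ assms(3) pos _ an assms(8,10) T1 assms(13)])
       (use assms(2) curve_ideal_form_iff(1)[where a = a, OF _ range] in \<open>auto simp: assms(12)\<close>)
  moreover have "delta_invariant n C (coord_point n) = enat (c2 - card C2) \<and>
      is_conductor c2 \<Gamma>2 \<and> C2 = \<Gamma>2 \<inter> {0..int c2 - 2}"
    by (rule chart_invariants[OF _ _ _ _ an assms(10,8) T2 \<Gamma>2])
       (use assms(2) lt curve_ideal_form_iff(2)[where a = a, OF _ range] in \<open>auto simp: assms(12)\<close>)
  ultimately show ?thesis by blast
qed

end
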